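(* Let $p(x)$ and $q(x)$ be differentiable (real- or complex-valued) functions on an open set $A\subseteq\mathbb{R}$, and let $$r(x)=\frac{p'(x)q(x)(1-q(x)^2)+2q'(x)q(x)^2(p(x)-1)}{2q'(x)(1-p(x))(q(x)^2-p(x))},$$ $$f(x)=\frac{p'(x)(p(x)^2-q(x)^2)-2q'(x)q(x)p(x)(p(x)-1)}{2p(x)(p(x)-1)(q(x)^2-p(x))},$$ where all denominators appearing here and below are assumed nonzero on $A$. Suppose that $r(x)$ is differentiable on $A$ and satisfies $$r'(x)-\left(f(x)+\frac{q'(x)}{q(x)}\right)r(x)=-\frac{p'(x)}{2p(x)(p(x)-1)}\qquad(x\in A),$$ and that $\Pi(p(x),q(x))$ and $K(q(x))$ are (defined and) differentiable on $A$. Let $F$ be an antiderivative of $f$ on $A$. Then for all $x\in A$ $$\Pi(p(x),q(x))+r(x)K(q(x))=s(x),$$ where $s(x)=C\,e^{F(x)}$ with $C$ a constant on each connected component of $A$.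
   Context: The complete elliptic integrals of the first and third kind are $$K(z)=\int_0^1\frac{dx}{\sqrt{(1-x^2)(1-z^2x^2)}},\qquad \Pi(n,z)=\int_0^1\frac{dx}{(1-nx^2)\sqrt{(1-x^2)(1-z^2x^2)}},$$ with principal branches of the square roots. *)

theory Defs
  imports "HOL-Analysis.Analysis"
begin

text \<open>
  The integrals are Henstock--Kurzweil integrals of complex-valued functions of a real variable,
  which subsume the (improper) Riemann and Lebesgue readings; the integral is ``defined''
  exactly if the integrand is integrable on \<open>{0..1}\<close>. No Cauchy principal value is taken.
  At points where a denominator vanishes the integrand takes the value 0 by convention, but this
  happens at only finitely many points of \<open>{0..1}\<close> and is irrelevant for the integral.
\<close>

definition ellK_integrand :: "complex \<Rightarrow> real \<Rightarrow> complex" where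
  "ellK_integrand z x =
     1 / csqrt ((1 - (of_real x)\<^sup>2) * (1 - z\<^sup>2 * (of_real x)\<^sup>2))"

definition ellPi_integrand :: "complex \<Rightarrow> complex \<Rightarrow> real \<Rightarrow> complex" where
  "ellPi_integrand n z x =
     1 / ((1 - n * (of_real x)\<^sup>2) *
          csqrt ((1 - (of_real x)\<^sup>2) * (1 - z\<^sup>2 * (of_real x)\<^sup>2)))"

definition ellK :: "complex \<Rightarrow> complex" where
  "ellK z = integral {0..1} (ellK_integrand z)"

definition ellPi :: "complex \<Rightarrow> complex \<Rightarrow> complex" where
  "ellPi n z = integral {0..1} (ellPi_integrand n z)"

end

theory Submission
  imports Defs
begin

text \<open>
  Write \<open>m = q\<^sup>2\<close>. The partial derivatives of \<open>\<Pi>\<close> and \<open>K\<close> are linear combinations of \<open>\<Pi>\<close>,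
  \<open>K\<close> and the integral \<open>E\<close> of the second kind. In the derivative of \<open>W = \<Pi> + r K\<close> along the curve, the choice of \<open>r\<close> makes the
  coefficient of \<open>E\<close> vanish, that of \<open>\<Pi>\<close> is \<open>f\<close>, and the differential equation for \<open>r\<close> makes
  that of \<open>K\<close> equal to \<open>f r\<close>. So \<open>W' = f W\<close>, and \<open>W exp (- F)\<close> is locally constant.

  The delicate point is that \<open>m\<close> may lie on the branch cut \<open>(1, \<infinity>)\<close>, for instance for real
  \<open>q > 1\<close>. There the principal branch gives the boundary values from the lower half plane. These are
  continuous together with the right-hand sides of the derivative formulas, so the formulas extend to
  the closed lower half plane. Values of \<open>m\<close> above the cut cannot accumulate at such a point, since
  \<open>K\<close> would jump by a nonzero amount, and \<open>K\<close> is assumed differentiable along the curve.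
  Integrability of the integrands excludes \<open>m = 1\<close> and \<open>p \<in> [1, \<infinity>)\<close>.
\<close>

subsection \<open>The integrand near its singularity\<close>

definition sin2 :: "real \<Rightarrow> complex" where
  "sin2 t = of_real ((sin t)\<^sup>2)"

lemma continuous_on_sin2 [continuous_intros]:
  "continuous_on S g \<Longrightarrow> continuous_on S (\<lambda>x. sin2 (g x))"
  for g :: "'a::t2_space \<Rightarrow> real"
  unfolding sin2_def by (intro continuous_intros)

lemma Re_sin2 [simp]: "Re (sin2 t) = (sin t)\<^sup>2"
  and Im_sin2 [simp]: "Im (sin2 t) = 0"
  by (simp_all add: sin2_def del: of_real_power)

text \<open>A continuous function on the whole plane that agrees with the principal root on the closed
  upper half plane, where \<open>1 - m sin\<^sup>2 t\<close> lies for \<open>Im m \<le> 0\<close>.\<close>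

definition usqrt :: "complex \<Rightarrow> complex" where
  "usqrt z = Complex (sqrt ((cmod z + Re z) / 2)) (sqrt ((cmod z - Re z) / 2))"

lemma usqrt_eq_csqrt: "Im z \<ge> 0 \<Longrightarrow> usqrt z = csqrt z"
  by (auto simp: usqrt_def complex_eq_iff sgn_if)

lemma continuous_on_usqrt [continuous_intros]:
  "continuous_on S g \<Longrightarrow> continuous_on S (\<lambda>x. usqrt (g x))"
  unfolding usqrt_def by (intro continuous_intros) auto

lemma cmod_usqrt: "cmod (usqrt z) = sqrt (cmod z)"
proof -
  have "cmod z + Re z \<ge> 0" "cmod z - Re z \<ge> 0"
    using abs_Re_le_cmod[of z] by linarith+
  then show ?thesis
    by (simp add: usqrt_def cmod_def[of "Complex _ _"] field_simps)
qed

lemma usqrt_eq_0_iff [simp]: "usqrt z = 0 \<longleftrightarrow> z = 0"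
  by (metis cmod_usqrt norm_eq_zero real_sqrt_eq_zero_cancel_iff)

text \<open>Half-angle argument: with \<open>x = u / 2\<close>, \<open>sin u\<close> is
  \<open>2 * tan x\<close> times the square of \<open>cos x\<close>, where
  \<open>\<bar>tan x\<bar> \<ge> \<bar>x\<bar>\<close>, and \<open>cos u \<ge> 0\<close> makes that
  square at least 1/2.\<close>

lemma abs_sin_ge_half:
  fixes u :: real
  assumes "\<bar>u\<bar> \<le> pi / 2"
  shows "\<bar>sin u\<bar> \<ge> \<bar>u\<bar> / 2"
proof -
  let ?x = "u / 2"
  have c: "cos ?x > 0"
    using assms pi_gt_zero by (intro cos_gt_zero_pi) linarith+
  have "\<bar>?x\<bar> < pi / 2"
    using assms pi_gt_zero by linarith
  then have "\<bar>?x\<bar> \<le> \<bar>tan ?x\<bar>"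
    by (rule abs_tan_ge)
  then have 1: "\<bar>?x\<bar> * cos ?x \<le> \<bar>sin ?x\<bar>"
    using c by (simp add: tan_def abs_div field_simps)
  have "cos u \<ge> 0"
    using assms by (intro cos_ge_zero) auto
  moreover have "cos u = 2 * (cos ?x)\<^sup>2 - 1"
    using cos_double_cos[of ?x] by simp
  ultimately have 2: "(cos ?x)\<^sup>2 \<ge> 1 / 2"
    by linarith
  have "\<bar>sin u\<bar> = 2 * \<bar>sin ?x\<bar> * cos ?x"
    using sin_double[of ?x] c by (simp add: abs_mult)
  also have "\<dots> \<ge> 2 * (\<bar>?x\<bar> * cos ?x) * cos ?x"
    using 1 c by (intro mult_right_mono) auto
  also have "2 * (\<bar>?x\<bar> * cos ?x) * cos ?x = \<bar>u\<bar> * (cos ?x)\<^sup>2"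
    by (simp add: power2_eq_square)
  also have "\<dots> \<ge> \<bar>u\<bar> * (1 / 2)"
    using 2 by (intro mult_left_mono) auto
  finally show ?thesis by simp
qed

text \<open>For \<open>a > 1\<close> this is the zero of 1 - a sin^2 t in the interval from 0 to
  pi/2, where the integrands on the cut become singular.\<close>

definition crit :: "real \<Rightarrow> real" where
  "crit a = arcsin (1 / sqrt a)"

lemma sin_crit: "a > 1 \<Longrightarrow> sin (crit a) = 1 / sqrt a"
  unfolding crit_def by (rule sin_arcsin) (use order_trans[of "-1" 0 "1 / sqrt a"] in auto)

lemma crit_bounds: assumes "a > 1" shows "0 < crit a" "crit a < pi / 2"
proof -
  have "0 < 1 / sqrt a" "1 / sqrt a < 1"
    using assms by auto
  moreover have "-1 \<le> 1 / sqrt a" "1 / sqrt a \<le> 1"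
    using calculation by linarith+
  ultimately have "arcsin 0 < arcsin (1 / sqrt a)" "arcsin (1 / sqrt a) < arcsin 1"
    by (safe intro!: arcsin_less_arcsin; linarith)+
  then show "0 < crit a" "crit a < pi / 2"
    unfolding crit_def by simp_all
qed

lemma cos_crit: assumes "a > 1" shows "cos (crit a) = sqrt (1 - 1 / a)"
proof -
  have "0 \<le> 1 / sqrt a" using assms by auto
  then have "-1 \<le> 1 / sqrt a" by linarith
  then show ?thesis
    using assms by (simp add: crit_def cos_arcsin power_divide)
qed

lemma isCont_crit: "a > 1 \<Longrightarrow> isCont crit a"
  unfolding crit_def
  by (intro continuous_intros isCont_o2[OF _ isCont_arcsin])
     (auto intro: less_le_trans[of "-1" 0])

text \<open>With \<open>a = Re m\<close> and \<open>u = crit a\<close>, the real part 1 - a sin^2 t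
  factors as \<open>a * sin (u + t) * sin (u - t)\<close>. The first factor
  \<open>a * sin (u + t)\<close> stays away from zero and \<open>\<bar>sin (u - t)\<bar>\<close> is
  at least \<open>\<bar>t - u\<bar> / 2\<close>. The constant depends on \<open>b\<close> only,
  which makes the estimate uniform in \<open>m\<close>.\<close>

lemma modulus_lower_bound:
  assumes b: "1 < b" "b \<le> Re m" and t: "t \<in> {0..pi/2}"
  shows "cmod (1 - m * sin2 t) \<ge> (min 1 (sqrt (b - 1)) / 2) * \<bar>t - crit (Re m)\<bar>"
proof -
  define a where "a = Re m"
  define u where "u = crit a"
  have a: "a > 1" "a \<ge> b" using b by (auto simp: a_def)
  have u: "0 < u" "u < pi / 2" using crit_bounds a unfolding u_def by auto
  have su: "sin u = 1 / sqrt a" and cu: "cos u = sqrt (1 - 1 / a)"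
    using sin_crit cos_crit a by (auto simp: u_def)
  \<comment> \<open>\<open>k\<close> lies below both \<open>a * sin u = sqrt a\<close> and
    \<open>a * cos u = sqrt (a * (a - 1))\<close>. By the addition formula
    \<open>a * sin (u + t)\<close> is then at least \<open>k * (cos t + sin t)\<close>, and
    \<open>sin t + cos t \<ge> 1\<close> on the quarter period.\<close>
  define k where "k = min 1 (sqrt (b - 1))"
  have ka: "k \<le> a * sin u" 
  proof -
    have "a * sin u = sqrt a" using a by (simp add: su real_div_sqrt)
    moreover have "1 \<le> sqrt a" using a by simp
    ultimately show ?thesis unfolding k_def by linarith
  qed
  have kc: "k \<le> a * cos u"
  proof -
    have "a * cos u = sqrt (a\<^sup>2 * (1 - 1 / a))"
      using a unfolding cu by (simp add: real_sqrt_mult)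
    also have "a\<^sup>2 * (1 - 1 / a) = a * (a - 1)"
      using a by (simp add: field_simps power2_eq_square)
    also have "sqrt (a * (a - 1)) \<ge> sqrt (b - 1)"
    proof (rule real_sqrt_le_mono)
      have "1 * (b - 1) \<le> a * (a - 1)" using a b by (intro mult_mono) auto
      then show "b - 1 \<le> a * (a - 1)" by simp
    qed
    finally show ?thesis unfolding k_def by linarith
  qed
  have k0: "k \<ge> 0" unfolding k_def using b by auto
  have st: "sin t \<ge> 0" "cos t \<ge> 0"
    using t by (auto intro!: sin_ge_zero cos_ge_zero)
  have sc: "sin t + cos t \<ge> 1"
  proof -
    have "(sin t + cos t)\<^sup>2 = 1 + 2 * (sin t * cos t)"
      unfolding power2_sum using sin_cos_squared_add[of t] by linarith
    moreover have "sin t * cos t \<ge> 0" using st by (rule mult_nonneg_nonneg)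
    ultimately have "1\<^sup>2 \<le> (sin t + cos t)\<^sup>2" by simp
    then show ?thesis
      by (rule power2_le_imp_le) (rule add_nonneg_nonneg[OF st])
  qed
  have 1: "a * sin (u + t) \<ge> k"
  proof -
    have "k * 1 \<le> k * (cos t + sin t)" using sc k0 by (intro mult_left_mono) auto
    also have "\<dots> = k * cos t + k * sin t" by (simp add: distrib_left)
    also have "\<dots> \<le> (a * sin u) * cos t + (a * cos u) * sin t"
      using ka kc st by (intro add_mono mult_right_mono) auto
    also have "\<dots> = a * sin (u + t)" by (simp add: sin_add algebra_simps)
    finally show ?thesis by simp
  qed
  have 2: "\<bar>sin (u - t)\<bar> \<ge> \<bar>t - u\<bar> / 2"
  proof -
    have "\<bar>u - t\<bar> \<le> pi / 2" using u t unfolding atLeastAtMost_iff by linarith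
    from abs_sin_ge_half[OF this] show ?thesis by (simp add: abs_minus_commute)
  qed
  have sp: "sin (u + t) * sin (u - t) = (sin u)\<^sup>2 - (sin t)\<^sup>2"
  proof -
    have "sin (u + t) * sin (u - t) = (sin u)\<^sup>2 * (cos t)\<^sup>2 - (cos u)\<^sup>2 * (sin t)\<^sup>2"
      by (simp add: sin_add sin_diff power2_eq_square algebra_simps)
    also have "\<dots> = (sin u)\<^sup>2 - (sin t)\<^sup>2"
      by (simp add: cos_squared_eq algebra_simps)
    finally show ?thesis .
  qed
  have "(k / 2) * \<bar>t - u\<bar> = k * (\<bar>t - u\<bar> / 2)" by simp
  also have "\<dots> \<le> a * sin (u + t) * \<bar>sin (u - t)\<bar>"
    using 1 2 k0 by (intro mult_mono) auto
  also have "\<dots> = \<bar>a * (sin (u + t) * sin (u - t))\<bar>"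
  proof -
    have "a * sin (u + t) \<ge> 0" using 1 k0 by linarith
    then show ?thesis by (metis abs_mult abs_of_nonneg mult.assoc)
  qed
  also have "a * (sin (u + t) * sin (u - t)) = 1 - a * (sin t)\<^sup>2"
    unfolding sp su using a by (simp add: power_divide algebra_simps)
  also have "\<bar>1 - a * (sin t)\<^sup>2\<bar> = \<bar>Re (1 - m * sin2 t)\<bar>"
    by (simp add: a_def)
  also have "\<dots> \<le> cmod (1 - m * sin2 t)" by (rule abs_Re_le_cmod)
  finally show ?thesis by (simp add: k_def u_def a_def)
qed

section \<open>The integrable majorant\<close>

text \<open>The window is large enough to contain every translate \<open>{-u..pi/2-u}\<close> with
  \<open>u\<close> in \<open>{0..pi/2}\<close>, since \<open>pi < 4\<close>.\<close>

lemma integrable_inverse_sqrt_abs: "(\<lambda>u::real. 1 / sqrt \<bar>u\<bar>) integrable_on {-2..2}"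
proof -
  have 1: "(\<lambda>u::real. u powr (-1/2)) integrable_on {0..2}"
    by (rule integrable_on_powr_from_0) auto
  have 2: "(\<lambda>u::real. 1 / sqrt \<bar>u\<bar>) integrable_on {0..2}"
    by (rule integrable_eq[OF 1]) (auto simp: powr_minus_divide powr_half_sqrt)
  have 3: "(\<lambda>u::real. 1 / sqrt \<bar>u\<bar>) integrable_on {-2..0}"
    using Henstock_Kurzweil_Integration.integrable_reflect_real[where f = "\<lambda>u::real. 1 / sqrt \<bar>u\<bar>" and a = 0 and b = 2] 2
    by (simp only: abs_minus_cancel minus_zero)
  show ?thesis
    by (rule Henstock_Kurzweil_Integration.integrable_combine[OF _ _ 3 2]) auto
qed

lemma integrable_inverse_sqrt_shift:
  assumes "u \<in> {0..pi/2}"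
  shows "(\<lambda>t::real. 1 / sqrt \<bar>t - u\<bar>) integrable_on {0..pi/2}"
proof -
  have "(\<lambda>u::real. 1 / sqrt \<bar>u\<bar>) integrable_on cbox (- u) (pi/2 - u)"
    using integrable_on_subinterval[OF integrable_inverse_sqrt_abs, of "-u" "pi/2 - u"] assms pi_less_4
    by auto
  then obtain I where "((\<lambda>u::real. 1 / sqrt \<bar>u\<bar>) has_integral I) (cbox (- u) (pi/2 - u))"
    by (auto simp: integrable_on_def)
  from has_integral_affinity'[OF this, of 1 "-u"] show ?thesis
    by (auto simp: integrable_on_def)
qed

subsection \<open>Continuity up to the branch cut from below\<close>

lemma Im_modulus_nonneg: "Im m \<le> 0 \<Longrightarrow> Im (1 - m * sin2 t) \<ge> 0"
  by (simp add: mult_nonpos_nonneg)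

text \<open>The root turns the linear lower bound on the modulus into an inverse square root
  singularity, which is integrable. The factor in front depends only on \<open>b\<close> and
  \<open>M\<close>.\<close>

lemma lower_integrand_bound:
  assumes b: "1 < b" "b \<le> Re m" and t: "t \<in> {0..pi/2}" "t \<noteq> crit (Re m)"
    and M: "cmod w \<le> M"
  shows "cmod (w / usqrt (1 - m * sin2 t)) \<le>
           M / sqrt (min 1 (sqrt (b - 1)) / 2) * (1 / sqrt \<bar>t - crit (Re m)\<bar>)"
proof -
  define k where "k = min 1 (sqrt (b - 1)) / 2"
  have k: "k > 0" using b by (simp add: k_def)
  have "0 < k * \<bar>t - crit (Re m)\<bar>" using k t by simp
  moreover have "k * \<bar>t - crit (Re m)\<bar> \<le> cmod (1 - m * sin2 t)"
    using modulus_lower_bound[OF b t(1)] by (simp add: k_def)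
  moreover have "M \<ge> 0" using M norm_ge_zero[of w] by linarith
  ultimately have "cmod w / sqrt (cmod (1 - m * sin2 t)) \<le> M / sqrt (k * \<bar>t - crit (Re m)\<bar>)"
    using M by (intro frac_le) auto
  then show ?thesis
    by (simp add: norm_divide cmod_usqrt real_sqrt_mult flip: k_def)
qed

lemma modulus_nonzero:
  assumes "1 < Re m" "t \<in> {0..pi/2}" "t \<noteq> crit (Re m)"
  shows "1 - m * sin2 t \<noteq> 0"
proof -
  have "0 < (min 1 (sqrt (Re m - 1)) / 2) * \<bar>t - crit (Re m)\<bar>"
    using assms by (intro mult_pos_pos) auto
  also have "\<dots> \<le> cmod (1 - m * sin2 t)"
    using modulus_lower_bound[of "Re m" m t] assms by simp
  finally show ?thesis by auto
qed

text \<open>Away from the critical point \<open>usqrt\<close> shows the integrand to be continuous,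
  hence measurable, and the inverse square root majorant applies. The removed point is
  negligible.\<close>

lemma lower_integrable:
  assumes m: "Im m \<le> 0" "1 < Re m" and g: "continuous_on {0..pi/2} g"
  shows "(\<lambda>t. g t / csqrt (1 - m * sin2 t)) absolutely_integrable_on {0..pi/2}"
proof -
  define u where "u = crit (Re m)"
  have u: "0 < u" "u < pi/2" using crit_bounds m by (auto simp: u_def)
  have "compact (g ` {0..pi/2})" by (intro compact_continuous_image g compact_Icc)
  then have "bounded (g ` {0..pi/2})" by (rule compact_imp_bounded)
  then obtain M where M: "\<And>t. t \<in> {0..pi/2} \<Longrightarrow> cmod (g t) \<le> M"
    unfolding bounded_iff by blast
  let ?S = "{0..pi/2} - {u}"
  let ?k = "sqrt (min 1 (sqrt (Re m - 1)) / 2)"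
  have S: "?S \<in> sets lebesgue" by auto
  have 1: "(\<lambda>t. g t / usqrt (1 - m * sin2 t)) absolutely_integrable_on ?S"
  proof (rule measurable_bounded_by_integrable_imp_absolutely_integrable
        [where g = "\<lambda>t. M / ?k * (1 / sqrt \<bar>t - u\<bar>)", OF _ S])
    have "continuous_on ?S (\<lambda>t. g t / usqrt (1 - m * sin2 t))"
      using modulus_nonzero[OF m(2)]
      by (intro continuous_intros continuous_on_subset[OF g]) (auto simp: u_def)
    then show "(\<lambda>t. g t / usqrt (1 - m * sin2 t)) \<in> borel_measurable (lebesgue_on ?S)"
      using S by (rule continuous_imp_measurable_on_sets_lebesgue)
    have "(\<lambda>t. 1 / sqrt \<bar>t - u\<bar>) integrable_on {0..pi/2}"
      using u by (intro integrable_inverse_sqrt_shift) auto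
    then have "(\<lambda>t. 1 / sqrt \<bar>t - u\<bar>) integrable_on ?S"
      by (rule integrable_spike_set) (auto intro: negligible_subset[of "{u}"])
    then show "(\<lambda>t. M / ?k * (1 / sqrt \<bar>t - u\<bar>)) integrable_on ?S"
      by (rule integrable_on_mult_right)
    show "norm (g t / usqrt (1 - m * sin2 t)) \<le> M / ?k * (1 / sqrt \<bar>t - u\<bar>)" if "t \<in> ?S" for t
      using lower_integrand_bound[of "Re m" m t "g t" M] that m M unfolding u_def by auto
  qed
  have 2: "usqrt (1 - m * sin2 t) = csqrt (1 - m * sin2 t)" for t
    by (intro usqrt_eq_csqrt Im_modulus_nonneg m)
  show ?thesis
    using 1 unfolding 2
    by (rule absolutely_integrable_spike_set) (auto intro: negligible_subset[of "{u}"])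
qed

text \<open>Translation by \<open>u\<close> and extension by zero bring the integrals for all
  critical points to one fixed domain, as dominated convergence requires. The finite set
  \<open>X\<close> leaves room to discard points without pointwise convergence.\<close>

lemma has_integral_shift_to_window:
  fixes F :: "real \<Rightarrow> complex"
  assumes F: "F integrable_on {0..pi/2}" and u: "0 < u" "u < pi/2" and X: "finite X"
  shows "((\<lambda>x. if x + u \<in> {0..pi/2} then F (x + u) else 0) has_integral
            integral {0..pi/2} F) ({-2..2} - X)"
proof -
  have "(F has_integral integral {0..pi/2} F) (cbox 0 (pi/2))"
    using F by (simp add: has_integral_integral)
  from has_integral_affinity'[OF this, of 1 u]
  have "((\<lambda>x. F (x + u)) has_integral integral {0..pi/2} F) {-u..pi/2-u}"
    by simp
  then have "((\<lambda>x. if x \<in> {-u..pi/2-u} then F (x + u) else 0) has_integral integral {0..pi/2} F) {-2..2}"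
    using u pi_less_4 by (subst has_integral_restrict) auto
  also have "(\<lambda>x. if x \<in> {-u..pi/2-u} then F (x + u) else 0) =
             (\<lambda>x. if x + u \<in> {0..pi/2} then F (x + u) else 0)"
    by (auto simp: fun_eq_iff)
  finally show ?thesis
    by (subst has_integral_spike_set_eq[where T = "{-2..2}"])
       (auto intro: negligible_subset[OF negligible_finite[OF X]])
qed

text \<open>The singularity \<open>crit (Re m)\<close> moves with \<open>m\<close>; translating it to the origin yields a
  dominating function that does not depend on \<open>m\<close>.\<close>

lemma continuous_on_lower_integral:
  fixes g :: "complex \<Rightarrow> real \<Rightarrow> complex"
  assumes U: "compact U" and g: "continuous_on (U \<times> {0..pi/2}) (\<lambda>(n,t). g n t)" and b: "1 < b"
  shows "continuous_on (U \<times> {m. Im m \<le> 0 \<and> b \<le> Re m})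
           (\<lambda>(n,m). integral {0..pi/2} (\<lambda>t. g n t / csqrt (1 - m * sin2 t)))"
proof (rule continuous_on_sequentiallyI)
  fix v :: "nat \<Rightarrow> complex \<times> complex" and a :: "complex \<times> complex"
  assume v: "\<forall>j. v j \<in> U \<times> {m. Im m \<le> 0 \<and> b \<le> Re m}"
    and a: "a \<in> U \<times> {m. Im m \<le> 0 \<and> b \<le> Re m}" and lim: "v \<longlonglongrightarrow> a"
  define G where "G = (\<lambda>w t. g (fst w) t / usqrt (1 - snd w * sin2 t))"
  define c where "c = (\<lambda>w::complex \<times> complex. crit (Re (snd w)))"
  define f where "f = (\<lambda>w x. if x + c w \<in> {0..pi/2} then G w (x + c w) else 0)"
  \<comment> \<open>Removed are the translated singularity 0 and the two points where the zero
    extension of the limit function may jump.\<close>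
  define S where "S = {-2..2} - {0, - c a, pi/2 - c a}"
  define I where "I = (\<lambda>w. integral {0..pi/2} (\<lambda>t. g (fst w) t / csqrt (1 - snd w * sin2 t)))"
  let ?T = "U \<times> {m. Im m \<le> 0 \<and> b \<le> Re m}"
  have c: "0 < c w" "c w < pi/2" if "w \<in> ?T" for w
    using that b crit_bounds[of "Re (snd w)"] by (auto simp: c_def)
  have "compact ((\<lambda>(n,t). g n t) ` (U \<times> {0..pi/2}))"
    by (intro compact_continuous_image g compact_Times U compact_Icc)
  then have "bounded ((\<lambda>(n,t). g n t) ` (U \<times> {0..pi/2}))" by (rule compact_imp_bounded)
  then obtain M where M: "\<And>n t. n \<in> U \<Longrightarrow> t \<in> {0..pi/2} \<Longrightarrow> cmod (g n t) \<le> M"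
    by (force simp: bounded_iff)
  have f_int: "(f w has_integral I w) S" if w: "w \<in> ?T" for w
  proof -
    have "continuous_on {0..pi/2} (g (fst w))"
      using continuous_on_compose2[OF g, of "{0..pi/2}" "\<lambda>t. (fst w, t)"] w
      by (force intro!: continuous_on_Pair continuous_on_const continuous_on_id)
    then have "(\<lambda>t. g (fst w) t / csqrt (1 - snd w * sin2 t)) absolutely_integrable_on {0..pi/2}"
      using w b by (intro lower_integrable) auto
    moreover have eq: "(\<lambda>t. g (fst w) t / csqrt (1 - snd w * sin2 t)) = G w"
    proof -
      have "usqrt (1 - snd w * sin2 t) = csqrt (1 - snd w * sin2 t)" for t
        using w by (intro usqrt_eq_csqrt Im_modulus_nonneg) auto
      then show ?thesis by (simp add: G_def)
    qed
    ultimately have "G w integrable_on {0..pi/2}"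
      using set_lebesgue_integral_eq_integral(1) by metis
    from has_integral_shift_to_window[OF this c[OF w], of "{0, - c a, pi/2 - c a}"]
    show ?thesis by (simp add: f_def S_def I_def eq)
  qed
  let ?h = "\<lambda>x. M / sqrt (min 1 (sqrt (b - 1)) / 2) * (1 / sqrt \<bar>x\<bar>)"
  have h: "?h integrable_on S"
  proof -
    have "(\<lambda>x. 1 / sqrt \<bar>x\<bar>) integrable_on S"
      unfolding S_def using integrable_inverse_sqrt_abs
      by (rule integrable_spike_set)
         (auto intro: negligible_subset[of "{0, - c a, pi/2 - c a}"])
    then show ?thesis by (rule integrable_on_mult_right)
  qed
  have bound: "norm (f w x) \<le> ?h x" if "w \<in> ?T" "x \<in> S" for w x
  proof (cases "x + c w \<in> {0..pi/2}")
    case True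
    then show ?thesis
      using that b M[of "fst w" "x + c w"]
        lower_integrand_bound[of b "snd w" "x + c w" "g (fst w) (x + c w)" M]
      by (auto simp: f_def G_def c_def S_def)
  next
    case False
    have "0 \<le> cmod (g (fst w) 0)" by simp
    also have "\<dots> \<le> M" using that by (intro M) auto
    finally have "M \<ge> 0" .
    then show ?thesis using False b by (auto simp: f_def)
  qed
  have cv: "(\<lambda>j. c (v j)) \<longlonglongrightarrow> c a"
  proof -
    have "isCont crit (Re (snd a))" using a b by (intro isCont_crit) auto
    then show ?thesis unfolding c_def
      by (rule isCont_tendsto_compose) (intro tendsto_intros lim)
  qed
  have conv: "(\<lambda>j. f (v j) x) \<longlonglongrightarrow> f a x" if x: "x \<in> S" for x
  proof -
    have xc: "(\<lambda>j. x + c (v j)) \<longlonglongrightarrow> x + c a" by (intro tendsto_intros cv)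
    consider "x + c a \<in> {0<..<pi/2}" | "x + c a < 0" | "x + c a > pi/2"
      using x by (force simp: S_def)
    then show ?thesis
    proof cases
      case 1
      have ev: "\<forall>\<^sub>F j in sequentially. x + c (v j) \<in> {0<..<pi/2}"
        using xc 1 by (intro topological_tendstoD) auto
      have "(\<lambda>j. (case (fst (v j), x + c (v j)) of (n,t) \<Rightarrow> g n t)) \<longlonglongrightarrow>
              (case (fst a, x + c a) of (n,t) \<Rightarrow> g n t)"
      proof (rule continuous_on_tendsto_compose[OF g])
        show "(\<lambda>j. (fst (v j), x + c (v j))) \<longlonglongrightarrow> (fst a, x + c a)"
          by (intro tendsto_intros lim xc)
        show "(fst a, x + c a) \<in> U \<times> {0..pi/2}" using a 1 by auto
        show "\<forall>\<^sub>F j in sequentially. (fst (v j), x + c (v j)) \<in> U \<times> {0..pi/2}"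
          using ev by eventually_elim (use v in \<open>auto simp: mem_Times_iff\<close>)
      qed
      moreover have "(\<lambda>j. usqrt (1 - snd (v j) * sin2 (x + c (v j)))) \<longlonglongrightarrow>
              usqrt (1 - snd a * sin2 (x + c a))"
      proof -
        have "continuous_on UNIV (\<lambda>(m,t). usqrt (1 - m * sin2 t))"
          unfolding case_prod_unfold by (intro continuous_intros)
        from continuous_on_tendsto_compose[OF this tendsto_Pair[OF tendsto_snd[OF lim] xc]]
        show ?thesis by simp
      qed
      moreover have "usqrt (1 - snd a * sin2 (x + c a)) \<noteq> 0"
        using modulus_nonzero[of "snd a" "x + c a"] a b 1 x by (auto simp: c_def S_def)
      ultimately have "(\<lambda>j. G (v j) (x + c (v j))) \<longlonglongrightarrow> G a (x + c a)"
        unfolding G_def by (auto intro: tendsto_divide)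
      moreover have "\<forall>\<^sub>F j in sequentially. G (v j) (x + c (v j)) = f (v j) x"
        using ev by eventually_elim (auto simp: f_def)
      moreover have "G a (x + c a) = f a x" using 1 by (simp add: f_def)
      ultimately show ?thesis by (metis Lim_transform_eventually)
    next
      case 2
      then have "\<forall>\<^sub>F j in sequentially. x + c (v j) < 0"
        using xc by (intro order_tendstoD)
      then have "\<forall>\<^sub>F j in sequentially. f (v j) x = 0"
        by eventually_elim (auto simp: f_def)
      moreover have "f a x = 0" using 2 by (simp add: f_def)
      ultimately show ?thesis by (simp add: tendsto_eventually)
    next
      case 3
      then have "\<forall>\<^sub>F j in sequentially. x + c (v j) > pi/2"
        using xc by (intro order_tendstoD)
      then have "\<forall>\<^sub>F j in sequentially. f (v j) x = 0"
        by eventually_elim (auto simp: f_def)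
      moreover have "f a x = 0" using 3 by (simp add: f_def)
      ultimately show ?thesis by (simp add: tendsto_eventually)
    qed
  qed
  have "(\<lambda>j. integral S (f (v j))) \<longlonglongrightarrow> integral S (f a)"
  proof (rule dominated_convergence(2)[OF _ h])
    show "f (v j) integrable_on S" for j using f_int[of "v j"] v by (meson has_integral_integrable)
    show "norm (f (v j) x) \<le> ?h x" if "x \<in> S" for j x using bound[of "v j" x] v that by blast
    show "(\<lambda>j. f (v j) x) \<longlonglongrightarrow> f a x" if "x \<in> S" for x using that by (rule conv)
  qed
  moreover have "integral S (f w) = I w" if "w \<in> ?T" for w
    using f_int[OF that] by (rule integral_unique)
  ultimately have "(\<lambda>j. I (v j)) \<longlonglongrightarrow> I a"
    using v a by simp
  then show "(\<lambda>j. case v j of (n,m) \<Rightarrow> integral {0..pi/2} (\<lambda>t. g n t / csqrt (1 - m * sin2 t)))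
      \<longlonglongrightarrow> (case a of (n,m) \<Rightarrow> integral {0..pi/2} (\<lambda>t. g n t / csqrt (1 - m * sin2 t)))"
    by (simp add: I_def case_prod_unfold)
qed

subsection \<open>Derivatives off the branch cut\<close>

text \<open>The complement of the ray \<open>[1, \<infinity>)\<close>. It serves both arguments: for
  \<open>m\<close> it keeps 1 - m sin^2 t off the cut of the principal root, and for
  \<open>n\<close> it keeps 1 - n sin^2 t away from zero.\<close>

definition slit :: "complex set" where
  "slit = {z. Im z \<noteq> 0 \<or> Re z < 1}"

lemma open_slit: "open slit"
  unfolding slit_def by (intro open_Collect_disj open_Collect_neq open_Collect_less continuous_intros)

lemma slit_modulus: "m \<in> slit \<Longrightarrow> 1 - m * sin2 t \<notin> \<real>\<^sub>\<le>\<^sub>0"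
proof
  assume m: "m \<in> slit" and "1 - m * sin2 t \<in> \<real>\<^sub>\<le>\<^sub>0"
  then have *: "1 \<le> Re m * (sin t)\<^sup>2" "Im m * (sin t)\<^sup>2 = 0"
    by (auto simp: complex_nonpos_Reals_iff)
  then have "Im m = 0" by auto
  then have "Re m < 1" using m by (simp add: slit_def)
  moreover have "(sin t)\<^sup>2 \<le> 1" by (simp add: abs_square_le_1)
  moreover have "Re m > 0"
  proof (rule ccontr)
    assume "\<not> Re m > 0"
    then have "Re m * (sin t)\<^sup>2 \<le> 0" by (intro mult_nonpos_nonneg) auto
    then show False using * by simp
  qed
  ultimately have "Re m * (sin t)\<^sup>2 \<le> Re m * 1" by (intro mult_left_mono) auto
  then show False using * \<open>Re m < 1\<close> by simp
qed

lemma slit_denominator: "n \<in> slit \<Longrightarrow> 1 - n * sin2 t \<noteq> 0"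
  using slit_modulus[of n t] by auto

lemma zero_in_slit: "0 \<in> slit" and one_notin_slit: "1 \<notin> slit"
  by (auto simp: slit_def)

text \<open>\<open>ellP\<close> is \<open>\<Pi>\<close> in terms of \<open>m = z\<^sup>2\<close> after \<open>x = sin t\<close>; \<open>ellQ\<close> and \<open>ellR\<close> are its partial
  derivatives in \<open>n\<close> and \<open>m\<close>, the latter written without the factor \<open>(1 - m sin\<^sup>2 t) powr (-3/2)\<close>,
  which is not integrable on the cut.\<close>

definition ellP :: "complex \<Rightarrow> complex \<Rightarrow> complex" where
  "ellP n m = integral {0..pi/2} (\<lambda>t. 1 / (1 - n * sin2 t) / csqrt (1 - m * sin2 t))"

definition ellQ :: "complex \<Rightarrow> complex \<Rightarrow> complex" where
  "ellQ n m = integral {0..pi/2} (\<lambda>t. sin2 t / (1 - n * sin2 t)\<^sup>2 / csqrt (1 - m * sin2 t))"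

definition ellE :: "complex \<Rightarrow> complex" where
  "ellE m = integral {0..pi/2} (\<lambda>t. csqrt (1 - m * sin2 t))"

definition ellR :: "complex \<Rightarrow> complex \<Rightarrow> complex" where
  "ellR n m = (ellP n m - ellE m / (1 - m)) / (2 * (n - m))"

lemma continuous_on_csqrt_slit:
  fixes f :: "'a::t2_space \<Rightarrow> complex"
  assumes "continuous_on S f" "continuous_on S g" "\<And>x. x \<in> S \<Longrightarrow> f x \<in> slit"
  shows "continuous_on S (\<lambda>x. csqrt (1 - f x * sin2 (g x)))"
  using assms slit_modulus
  by (intro continuous_on_compose2[OF continuous_on_csqrt] continuous_intros) auto

lemma continuous_on_slit_integrand:
  assumes "m \<in> slit" "continuous_on {0..pi/2} g"
  shows "continuous_on {0..pi/2} (\<lambda>t. g t / csqrt (1 - m * sin2 t))"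
  using assms slit_denominator by (intro continuous_intros continuous_on_csqrt_slit) auto

lemma slit_absolutely_integrable:
  assumes "m \<in> slit" "continuous_on {0..pi/2} g"
  shows "(\<lambda>t. g t / csqrt (1 - m * sin2 t)) absolutely_integrable_on {0..pi/2}"
  by (intro absolutely_integrable_continuous_real continuous_on_slit_integrand assms)

lemma continuous_on_P_weight: "n \<in> slit \<Longrightarrow> continuous_on S (\<lambda>t. 1 / (1 - n * sin2 t))"
  using slit_denominator by (intro continuous_intros) auto

lemma continuous_on_Q_weight: "n \<in> slit \<Longrightarrow> continuous_on S (\<lambda>t. sin2 t / (1 - n * sin2 t)\<^sup>2)"
  using slit_denominator by (intro continuous_intros) auto

section \<open>Relations between the integrals from exact derivatives\<close>

text \<open>The differentiated function vanishes at 0 and at pi/2. Integrating the identity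
  therefore expresses the integral of the inverse cube of the root through
  \<open>ellE m\<close>.\<close>

lemma has_vector_derivative_sin_cos_over_root:
  assumes "m \<in> slit"
  shows "((\<lambda>t. m * of_real (sin t * cos t) / csqrt (1 - m * sin2 t)) has_vector_derivative
           (csqrt (1 - m * sin2 t) - (1 - m) / csqrt (1 - m * sin2 t) ^ 3)) (at t within X)"
proof -
  let ?z = "of_real t :: complex"
  define D where "D = csqrt (1 - m * sin2 t)"
  define s c where "s = sin ?z" and "c = cos ?z"
  have s2: "sin2 t = s\<^sup>2" by (simp add: sin2_def s_def sin_of_real)
  have D0: "D \<noteq> 0" using slit_denominator[OF assms] by (simp add: D_def)
  have D2: "D\<^sup>2 = 1 - m * s\<^sup>2" by (simp add: D_def s2)
  have c2: "c\<^sup>2 = 1 - s\<^sup>2" unfolding s_def c_def by (rule cos_squared_eq)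
  \<comment> \<open>The differentiation is carried out in a complex variable, where the derivative
    rule for the principal root applies, and is restricted to real \<open>t\<close>
    afterwards.\<close>
  have "((\<lambda>z. m * (sin z * cos z) / csqrt (1 - m * (sin z)\<^sup>2)) has_field_derivative
      ((m * (c * c - s * s)) * D - m * (s * c) * (- (m * (2 * s * c)) / (2 * D))) / (D * D)) (at ?z)"
    using slit_modulus[OF assms, of t] D0 unfolding D_def s2 s_def c_def
    by (auto intro!: derivative_eq_intros simp: algebra_simps)
  moreover have "((m * (c * c - s * s)) * D - m * (s * c) * (- (m * (2 * s * c)) / (2 * D))) / (D * D) =
      D - (1 - m) / D ^ 3"
  proof -
    have "((m * (c * c - s * s)) * D - m * (s * c) * (- (m * (2 * s * c)) / (2 * D))) / (D * D) =
      (m * (c\<^sup>2 - s\<^sup>2) * D\<^sup>2 + m\<^sup>2 * s\<^sup>2 * c\<^sup>2) / D ^ 3"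
      using D0 by (simp add: field_simps power2_eq_square power3_eq_cube)
    also have "m * (c\<^sup>2 - s\<^sup>2) * D\<^sup>2 + m\<^sup>2 * s\<^sup>2 * c\<^sup>2 = D\<^sup>2 * D\<^sup>2 - (1 - m)"
      unfolding D2 c2 by (simp add: algebra_simps power2_eq_square)
    also have "\<dots> / D ^ 3 = D - (1 - m) / D ^ 3"
      using D0 by (simp add: field_simps power2_eq_square power3_eq_cube)
    finally show ?thesis .
  qed
  ultimately have "((\<lambda>x. m * (sin (of_real x) * cos (of_real x)) / csqrt (1 - m * (sin (of_real x))\<^sup>2))
      has_vector_derivative D - (1 - m) / D ^ 3) (at t within X)"
    by (intro has_vector_derivative_real_field) simp
  then show ?thesis by (simp add: sin2_def D_def sin_of_real cos_of_real)
qed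

lemma has_integral_inverse_cube:
  assumes m: "m \<in> slit"
  shows "((\<lambda>t. 1 / csqrt (1 - m * sin2 t) ^ 3) has_integral ellE m / (1 - m)) {0..pi/2}"
proof -
  have "((\<lambda>t. csqrt (1 - m * sin2 t) - (1 - m) / csqrt (1 - m * sin2 t) ^ 3) has_integral
     (m * of_real (sin (pi/2) * cos (pi/2)) / csqrt (1 - m * sin2 (pi/2)) -
      m * of_real (sin 0 * cos 0) / csqrt (1 - m * sin2 0))) {0..pi/2}"
    by (intro fundamental_theorem_of_calculus has_vector_derivative_sin_cos_over_root m) simp
  then have 1: "((\<lambda>t. csqrt (1 - m * sin2 t) - (1 - m) / csqrt (1 - m * sin2 t) ^ 3) has_integral 0) {0..pi/2}"
    by simp
  have 2: "((\<lambda>t. csqrt (1 - m * sin2 t)) has_integral ellE m) {0..pi/2}"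
    unfolding ellE_def
    by (intro integrable_integral integrable_continuous_real continuous_on_csqrt_slit continuous_intros m)
  have "m \<noteq> 1" using m one_notin_slit by auto
  then show ?thesis
    using has_integral_divide[OF has_integral_diff[OF 2 1], of "1 - m"] by simp
qed

lemma has_integral_slit:
  assumes "m \<in> slit" "n \<in> slit"
  shows has_integral_ellP:
      "((\<lambda>t. 1 / (1 - n * sin2 t) / csqrt (1 - m * sin2 t)) has_integral ellP n m) {0..pi/2}"
    and has_integral_ellQ:
      "((\<lambda>t. sin2 t / (1 - n * sin2 t)\<^sup>2 / csqrt (1 - m * sin2 t)) has_integral ellQ n m) {0..pi/2}"
    and has_integral_ellE:
      "((\<lambda>t. csqrt (1 - m * sin2 t)) has_integral ellE m) {0..pi/2}"
  unfolding ellP_def ellQ_def ellE_def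
  by (intro integrable_integral integrable_continuous_real continuous_on_slit_integrand
      continuous_on_csqrt_slit continuous_on_P_weight continuous_on_Q_weight continuous_intros assms)+

text \<open>Partial fractions: with \<open>D\<close> the root and \<open>N\<close> = 1 - n sin^2 t,
  the difference of \<open>D\<^sup>2\<close> and \<open>N\<close> is (n - m) sin^2 t. The
  \<open>m\<close>-derivative of the integrand of \<open>ellP\<close> thus splits into that
  integrand and the inverse cube, which accounts for the formula defining
  \<open>ellR\<close>.\<close>

lemma has_integral_ellR:
  assumes m: "m \<in> slit" and n: "n \<in> slit" and nm: "n \<noteq> m"
  shows "((\<lambda>t. 1 / (1 - n * sin2 t) * (sin2 t / (2 * csqrt (1 - m * sin2 t) ^ 3)))
            has_integral ellR n m) {0..pi/2}"
proof -
  have "((\<lambda>t. (1 / (1 - n * sin2 t) / csqrt (1 - m * sin2 t) - 1 / csqrt (1 - m * sin2 t) ^ 3)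
      / (2 * (n - m))) has_integral ellR n m) {0..pi/2}"
    unfolding ellR_def
    by (intro has_integral_divide has_integral_diff has_integral_ellP has_integral_inverse_cube m n)
  moreover have "(1 / (1 - n * sin2 t) / csqrt (1 - m * sin2 t) - 1 / csqrt (1 - m * sin2 t) ^ 3)
      / (2 * (n - m)) = 1 / (1 - n * sin2 t) * (sin2 t / (2 * csqrt (1 - m * sin2 t) ^ 3))" for t
  proof -
    define D N where "D = csqrt (1 - m * sin2 t)" and "N = 1 - n * sin2 t"
    have 0: "D \<noteq> 0" "N \<noteq> 0"
      using slit_denominator[OF m] slit_denominator[OF n] by (auto simp: D_def N_def)
    have "D\<^sup>2 - N = (n - m) * sin2 t" by (simp add: D_def N_def algebra_simps)
    moreover have "1 / N / D - 1 / D ^ 3 = (D\<^sup>2 - N) / (N * D ^ 3)"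
      using 0 by (simp add: field_simps power2_eq_square power3_eq_cube)
    ultimately have "1 / N / D - 1 / D ^ 3 = (n - m) * sin2 t / (N * D ^ 3)" by simp
    moreover have "k * a / b / (2 * k) = a / (2 * b)" if "k \<noteq> 0" for k a b :: complex
      using that by simp
    ultimately have "(1 / N / D - 1 / D ^ 3) / (2 * (n - m)) = sin2 t / (2 * (N * D ^ 3))"
      using nm by (metis right_minus_eq)
    then show ?thesis by (simp add: ac_simps flip: D_def N_def)
  qed
  ultimately show ?thesis by simp
qed

text \<open>The factor \<open>n\<^sup>2\<close> clears denominators, so that no case distinction at \<open>n = 0\<close> is needed.\<close>

lemma has_vector_derivative_sin_cos_root_over:
  assumes "m \<in> slit" "n \<in> slit"
  shows "((\<lambda>t. n\<^sup>2 * of_real (sin t * cos t) * csqrt (1 - m * sin2 t) / (1 - n * sin2 t))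
           has_vector_derivative
           (2 * n * (n - 1) * (n - m) * (sin2 t / (1 - n * sin2 t)\<^sup>2 / csqrt (1 - m * sin2 t))
            + n * csqrt (1 - m * sin2 t)
            + (m - n) * (1 / (1 - 0 * sin2 t) / csqrt (1 - m * sin2 t))
            + (n\<^sup>2 - m) * (1 / (1 - n * sin2 t) / csqrt (1 - m * sin2 t)))) (at t within X)"
    (is "(_ has_vector_derivative ?d) _")
proof -
  let ?z = "of_real t :: complex"
  define D where "D = csqrt (1 - m * sin2 t)"
  define s c where "s = sin ?z" and "c = cos ?z"
  define N where "N = 1 - n * s\<^sup>2"
  have s2: "sin2 t = s\<^sup>2" by (simp add: sin2_def s_def sin_of_real)
  have D0: "D \<noteq> 0" using slit_denominator[OF assms(1)] by (simp add: D_def)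
  have N0: "N \<noteq> 0" using slit_denominator[OF assms(2), of t] by (simp add: N_def s2)
  have D2: "D\<^sup>2 = 1 - m * s\<^sup>2" by (simp add: D_def s2)
  have c2: "c\<^sup>2 = 1 - s\<^sup>2" unfolding s_def c_def by (rule cos_squared_eq)
  let ?d' = "(n\<^sup>2 * ((c * c - s * s) * D + (s * c) * (- (m * (2 * s * c)) / (2 * D))) * N
       - n\<^sup>2 * (s * c) * D * (- (n * (2 * s * c)))) / (N * N)"
  have "((\<lambda>z. n\<^sup>2 * (sin z * cos z) * csqrt (1 - m * (sin z)\<^sup>2) / (1 - n * (sin z)\<^sup>2))
      has_field_derivative ?d') (at ?z)"
    using slit_modulus[OF assms(1), of t] D0 N0 unfolding D_def s2 s_def c_def N_def
    by (auto intro!: derivative_eq_intros simp: algebra_simps)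
  moreover have "?d' = ?d"
  proof -
    have "?d' = (n\<^sup>2 * ((c\<^sup>2 - s\<^sup>2) * D\<^sup>2 * N - m * s\<^sup>2 * c\<^sup>2 * N + 2 * n * s\<^sup>2 * c\<^sup>2 * D\<^sup>2)) / (D * N\<^sup>2)"
      \<comment> \<open>Over the common denominator the claim becomes a polynomial identity in
        \<open>n\<close>, \<open>m\<close> and \<open>s\<close>, because the squares of
        \<open>D\<close> and \<open>c\<close> are polynomials in \<open>s\<close>.\<close>
      using D0 N0 by (simp add: field_simps power2_eq_square)
    also have "n\<^sup>2 * ((c\<^sup>2 - s\<^sup>2) * D\<^sup>2 * N - m * s\<^sup>2 * c\<^sup>2 * N + 2 * n * s\<^sup>2 * c\<^sup>2 * D\<^sup>2) =
       2 * n * (n - 1) * (n - m) * s\<^sup>2 + n * D\<^sup>2 * N\<^sup>2 + (m - n) * N\<^sup>2 + (n\<^sup>2 - m) * N"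
      unfolding D2 c2 N_def by algebra
    also have "\<dots> / (D * N\<^sup>2) = 2 * n * (n - 1) * (n - m) * (s\<^sup>2 / N\<^sup>2 / D) + n * D
       + (m - n) * (1 / D) + (n\<^sup>2 - m) * (1 / N / D)"
      using D0 N0 by (simp add: add_divide_distrib power2_eq_square) (simp add: ac_simps)
    finally show ?thesis by (simp add: D_def N_def s2)
  qed
  ultimately have "((\<lambda>x. n\<^sup>2 * (sin (of_real x) * cos (of_real x)) * csqrt (1 - m * (sin (of_real x))\<^sup>2)
      / (1 - n * (sin (of_real x))\<^sup>2)) has_vector_derivative ?d) (at t within X)"
    by (intro has_vector_derivative_real_field) simp
  then show ?thesis by (simp add: sin2_def sin_of_real cos_of_real)
qed

text \<open>The function differentiated in the preceding lemma vanishes at both ends of the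
  interval, so its derivative integrates to zero. This allows \<open>ellQ\<close> to be eliminated
  in favour of \<open>ellP\<close>, \<open>ellE\<close> and the first kind, \<open>ellP 0 m\<close>.
  The trivial factor \<open>1 - 0 * sin2 t\<close> only matches the integrand of
  \<open>ellP 0 m\<close>.\<close>

lemma ellQ_relation:
  assumes m: "m \<in> slit" and n: "n \<in> slit"
  shows "2 * n * (n - 1) * (n - m) * ellQ n m + n * ellE m + (m - n) * ellP 0 m + (n\<^sup>2 - m) * ellP n m = 0"
proof -
  let ?f = "\<lambda>t. 2 * n * (n - 1) * (n - m) * (sin2 t / (1 - n * sin2 t)\<^sup>2 / csqrt (1 - m * sin2 t))
            + n * csqrt (1 - m * sin2 t)
            + (m - n) * (1 / (1 - 0 * sin2 t) / csqrt (1 - m * sin2 t))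
            + (n\<^sup>2 - m) * (1 / (1 - n * sin2 t) / csqrt (1 - m * sin2 t))"
  have "(?f has_integral
     (n\<^sup>2 * of_real (sin (pi/2) * cos (pi/2)) * csqrt (1 - m * sin2 (pi/2)) / (1 - n * sin2 (pi/2)) -
      n\<^sup>2 * of_real (sin 0 * cos 0) * csqrt (1 - m * sin2 0) / (1 - n * sin2 0))) {0..pi/2}"
    by (intro fundamental_theorem_of_calculus has_vector_derivative_sin_cos_root_over m n) simp
  then have "(?f has_integral 0) {0..pi/2}" by simp
  moreover have "(?f has_integral
      2 * n * (n - 1) * (n - m) * ellQ n m + n * ellE m + (m - n) * ellP 0 m + (n\<^sup>2 - m) * ellP n m) {0..pi/2}"
    by (intro has_integral_add has_integral_mult_right has_integral_ellP has_integral_ellQ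
        has_integral_ellE[OF m n] m n zero_in_slit)
  ultimately show ?thesis using has_integral_unique by blast
qed

text \<open>Differentiation under the integral sign on a product of balls inside
  \<open>slit\<close>. The derivative is taken jointly, since both arguments move along the
  curve.\<close>

lemma ellP_has_derivative_slit:
  assumes m: "m \<in> slit" and n: "n \<in> slit" and nm: "n \<noteq> m"
  shows "((\<lambda>w. ellP (fst w) (snd w)) has_derivative (\<lambda>h. ellQ n m * fst h + ellR n m * snd h)) (at (n, m))"
proof -
  obtain r1 r2 where r: "r1 > 0" "r2 > 0" "ball n r1 \<subseteq> slit" "ball m r2 \<subseteq> slit"
    using open_slit m n by (meson open_contains_ball)
  define U where "U = ball n r1 \<times> ball m r2"
  have U: "fst w \<in> slit" "snd w \<in> slit" if "w \<in> U" for w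
    using that r by (auto simp: U_def mem_Times_iff)
  have nmU: "(n, m) \<in> U" using r by (simp add: U_def)
  have openU: "open U" unfolding U_def by (intro open_Times open_ball)
  define A where "A = (\<lambda>w t. sin2 t / (1 - fst w * sin2 t)\<^sup>2 / csqrt (1 - snd w * sin2 t))"
  define B where "B = (\<lambda>w t. 1 / (1 - fst w * sin2 t) * (sin2 t / (2 * csqrt (1 - snd w * sin2 t) ^ 3)))"
  \<comment> \<open>The total derivative is a bounded linear function, so that it can be integrated
    over \<open>t\<close> as a whole. Evaluation at a direction \<open>h\<close> then commutes with
    the integral.\<close>
  define D where "D = (\<lambda>w t. (blinfun_mult_right (A w t) o\<^sub>L fst_blinfun) +
                         (blinfun_mult_right (B w t) o\<^sub>L snd_blinfun))"
  have Dapp: "blinfun_apply (D w t) = (\<lambda>h. A w t * fst h + B w t * snd h)" for w t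
    by (simp add: D_def fun_eq_iff blinfun.add_left)
  have "((\<lambda>w. integral (cbox 0 (pi/2)) (\<lambda>t. 1 / (1 - fst w * sin2 t) / csqrt (1 - snd w * sin2 t)))
         has_derivative integral (cbox 0 (pi/2)) (D (n, m))) (at (n, m) within U)"
  proof (rule leibniz_rule)
    fix w t assume w: "w \<in> U" and t: "t \<in> cbox 0 (pi/2)"
    have 0: "1 - fst w * sin2 t \<noteq> 0" "1 - snd w * sin2 t \<notin> \<real>\<^sub>\<le>\<^sub>0" "1 - snd w * sin2 t \<noteq> 0"
      using U[OF w] slit_denominator slit_modulus by auto
    have "((\<lambda>x. 1 / (1 - x * sin2 t)) has_field_derivative sin2 t / (1 - fst w * sin2 t)\<^sup>2) (at (fst w))"
      using 0 by (auto intro!: derivative_eq_intros simp: power2_eq_square)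
    then have 1: "((\<lambda>w. 1 / (1 - fst w * sin2 t)) has_derivative
        (\<lambda>h. sin2 t / (1 - fst w * sin2 t)\<^sup>2 * fst h)) (at w within U)"
      unfolding has_field_derivative_def
      by (rule has_derivative_compose[OF has_derivative_fst[OF has_derivative_ident]])
    have "((\<lambda>x. 1 / csqrt (1 - x * sin2 t)) has_field_derivative
        sin2 t / (2 * csqrt (1 - snd w * sin2 t) ^ 3)) (at (snd w))"
      using 0 by (auto intro!: derivative_eq_intros simp: power3_eq_cube field_simps)
    then have 2: "((\<lambda>w. 1 / csqrt (1 - snd w * sin2 t)) has_derivative
        (\<lambda>h. sin2 t / (2 * csqrt (1 - snd w * sin2 t) ^ 3) * snd h)) (at w within U)"
      unfolding has_field_derivative_def
      by (rule has_derivative_compose[OF has_derivative_snd[OF has_derivative_ident]])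
    show "((\<lambda>w. 1 / (1 - fst w * sin2 t) / csqrt (1 - snd w * sin2 t)) has_derivative
        blinfun_apply (D w t)) (at w within U)"
      using has_derivative_mult[OF 1 2] unfolding Dapp A_def B_def
      by (simp add: algebra_simps)
  next
    fix w assume w: "w \<in> U"
    show "(\<lambda>t. 1 / (1 - fst w * sin2 t) / csqrt (1 - snd w * sin2 t)) integrable_on cbox 0 (pi/2)"
      using has_integral_ellP[OF U(2)[OF w] U(1)[OF w]] by auto
  next
    have "continuous_on (U \<times> cbox 0 (pi/2)) (\<lambda>(w,t). A w t)"
      "continuous_on (U \<times> cbox 0 (pi/2)) (\<lambda>(w,t). B w t)"
      unfolding A_def B_def case_prod_unfold using U slit_denominator
      by (auto intro!: continuous_intros continuous_on_csqrt_slit)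
    then show "continuous_on (U \<times> cbox 0 (pi/2)) (\<lambda>(w,t). D w t)"
      unfolding D_def case_prod_unfold
      by (intro continuous_intros bounded_linear.continuous_on[OF bounded_linear_blinfun_mult_right])
  next
    show "(n, m) \<in> U" by (rule nmU)
    show "convex U" unfolding U_def by (intro convex_Times convex_ball)
  qed
  moreover have "blinfun_apply (integral (cbox 0 (pi/2)) (D (n, m))) = (\<lambda>h. ellQ n m * fst h + ellR n m * snd h)"
  proof
    fix h :: "complex \<times> complex"
    have D: "D (n, m) integrable_on cbox 0 (pi/2)"
    proof (rule integrable_continuous)
      show "continuous_on (cbox 0 (pi/2)) (D (n, m))"
        unfolding D_def A_def B_def using m n slit_denominator
        by (auto intro!: continuous_intros continuous_on_csqrt_slit
            bounded_linear.continuous_on[OF bounded_linear_blinfun_mult_right])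
    qed
    have "blinfun_apply (integral (cbox 0 (pi/2)) (D (n, m))) h =
          integral (cbox 0 (pi/2)) (\<lambda>t. blinfun_apply (D (n, m) t) h)"
      using D by (rule blinfun_apply_integral)
    also have "\<dots> = integral {0..pi/2} (\<lambda>t. A (n, m) t * fst h + B (n, m) t * snd h)"
      by (simp add: Dapp)
    also have "\<dots> = ellQ n m * fst h + ellR n m * snd h"
      unfolding A_def B_def fst_conv snd_conv
      by (intro integral_unique has_integral_add has_integral_mult_left has_integral_ellQ has_integral_ellR m n nm)
    finally show "blinfun_apply (integral (cbox 0 (pi/2)) (D (n, m))) h = ellQ n m * fst h + ellR n m * snd h" .
  qed
  ultimately show ?thesis
    using at_within_open[OF nmU openU] by (simp add: ellP_def)
qed

subsection \<open>Derivatives on the branch cut\<close>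

lemma continuous_on_ellP_lower:
  assumes "compact U" "U \<subseteq> slit" "1 < b"
  shows "continuous_on (U \<times> {m. Im m \<le> 0 \<and> b \<le> Re m}) (\<lambda>w. ellP (fst w) (snd w))"
proof -
  have "continuous_on (U \<times> {0..pi/2}) (\<lambda>(n,t). 1 / (1 - n * sin2 t))"
    unfolding case_prod_unfold using assms(2) slit_denominator by (auto intro!: continuous_intros)
  from continuous_on_lower_integral[OF assms(1) this assms(3)] show ?thesis
    by (simp add: ellP_def case_prod_unfold)
qed

lemma continuous_on_ellQ_lower:
  assumes "compact U" "U \<subseteq> slit" "1 < b"
  shows "continuous_on (U \<times> {m. Im m \<le> 0 \<and> b \<le> Re m}) (\<lambda>w. ellQ (fst w) (snd w))"
proof -
  have "continuous_on (U \<times> {0..pi/2}) (\<lambda>(n,t). sin2 t / (1 - n * sin2 t)\<^sup>2)"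
    unfolding case_prod_unfold using assms(2) slit_denominator by (auto intro!: continuous_intros)
  from continuous_on_lower_integral[OF assms(1) this assms(3)] show ?thesis
    by (simp add: ellQ_def case_prod_unfold)
qed

text \<open>The root stands in the numerator, so there is no singularity: continuity of
  \<open>usqrt\<close> on the whole plane is enough for the parameter integral.\<close>

lemma continuous_on_ellE_lower: "continuous_on {m. Im m \<le> 0} ellE"
proof -
  have "continuous_on {m. Im m \<le> 0} (\<lambda>m. integral (cbox 0 (pi/2)) (\<lambda>t. usqrt (1 - m * sin2 t)))"
    by (rule integral_continuous_on_param) (auto simp: case_prod_unfold intro!: continuous_intros)
  then show ?thesis
  proof (rule continuous_on_eq)
    fix m assume "m \<in> {m. Im m \<le> 0}"
    then have "usqrt (1 - m * sin2 t) = csqrt (1 - m * sin2 t)" for t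
      by (intro usqrt_eq_csqrt Im_modulus_nonneg) simp
    then show "integral (cbox 0 (pi/2)) (\<lambda>t. usqrt (1 - m * sin2 t)) = ellE m"
      by (simp add: ellE_def)
  qed
qed

section \<open>Approach to the cut from below\<close>

text \<open>The shift is independent of \<open>m\<close>. As a map of \<open>m\<close> this is a
  translation, with the identity as derivative, and it converges uniformly to the identity as
  \<open>k\<close> grows.\<close>

definition lowered :: "complex \<Rightarrow> real \<Rightarrow> nat \<Rightarrow> complex" where
  "lowered m d k = m - \<i> * of_real (d / real (Suc k))"

lemma lowered_tendsto: "lowered m d \<longlonglongrightarrow> m"
proof -
  have "(\<lambda>k. m - \<i> * of_real (d * inverse (real (Suc k)))) \<longlonglongrightarrow> m - \<i> * of_real (d * 0)"
    by (intro tendsto_intros LIMSEQ_inverse_real_of_nat)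
  then show ?thesis by (simp add: lowered_def[abs_def] divide_inverse)
qed

lemma Re_lowered [simp]: "Re (lowered m d k) = Re m"
  and Im_lowered: "Im (lowered m d k) = Im m - d / real (Suc k)"
  by (simp_all add: lowered_def)

lemma dist_lowered: "d > 0 \<Longrightarrow> dist (lowered m d k) m = d / real (Suc k)"
  by (simp add: lowered_def dist_norm norm_mult norm_divide del: of_nat_Suc)

lemma lowered_in_slit: "Im m \<le> 0 \<Longrightarrow> d > 0 \<Longrightarrow> lowered m d k \<in> slit"
  and Im_lowered_le: "Im m \<le> 0 \<Longrightarrow> d > 0 \<Longrightarrow> Im (lowered m d k) \<le> 0"
proof -
  assume "Im m \<le> 0" "d > 0"
  moreover from this have "d / real (Suc k) > 0" by simp
  ultimately have "Im (lowered m d k) < 0" unfolding Im_lowered by linarith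
  then show "lowered m d k \<in> slit" "Im (lowered m d k) \<le> 0" by (auto simp: slit_def)
qed

text \<open>The relation holds at the points \<open>lowered m 1 k\<close>, which lie in
  \<open>slit\<close>, and passes to the limit because every integral in it is continuous from
  below.\<close>

lemma ellQ_relation_lower:
  assumes m: "Im m \<le> 0" "1 < Re m" and n: "n \<in> slit"
  shows "2 * n * (n - 1) * (n - m) * ellQ n m + n * ellE m + (m - n) * ellP 0 m + (n\<^sup>2 - m) * ellP n m = 0"
proof -
  let ?m = "lowered m 1"
  let ?X = "{m'. Im m' \<le> 0 \<and> Re m \<le> Re m'}"
  have mX: "m \<in> ?X" "?m k \<in> ?X" for k
    using m Im_lowered_le[of m 1] by auto
  have P: "(\<lambda>k. ellP n' (?m k)) \<longlonglongrightarrow> ellP n' m" if "n' \<in> slit" for n'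
    using continuous_on_tendsto_compose[OF continuous_on_ellP_lower[of "{n'}" "Re m"]
        tendsto_Pair[OF tendsto_const lowered_tendsto], of n' m 1] that m mX by simp
  have Q: "(\<lambda>k. ellQ n (?m k)) \<longlonglongrightarrow> ellQ n m"
    using continuous_on_tendsto_compose[OF continuous_on_ellQ_lower[of "{n}" "Re m"]
        tendsto_Pair[OF tendsto_const lowered_tendsto], of n m 1] n m mX by simp
  have E: "(\<lambda>k. ellE (?m k)) \<longlonglongrightarrow> ellE m"
    using continuous_on_tendsto_compose[OF continuous_on_ellE_lower lowered_tendsto, of m 1] mX by simp
  have "(\<lambda>k. 2 * n * (n - 1) * (n - ?m k) * ellQ n (?m k) + n * ellE (?m k)
         + (?m k - n) * ellP 0 (?m k) + (n\<^sup>2 - ?m k) * ellP n (?m k)) \<longlonglongrightarrow>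
      2 * n * (n - 1) * (n - m) * ellQ n m + n * ellE m + (m - n) * ellP 0 m + (n\<^sup>2 - m) * ellP n m"
    by (intro tendsto_intros lowered_tendsto P Q E n zero_in_slit)
  moreover have "2 * n * (n - 1) * (n - ?m k) * ellQ n (?m k) + n * ellE (?m k)
         + (?m k - n) * ellP 0 (?m k) + (n\<^sup>2 - ?m k) * ellP n (?m k) = 0" for k
    using m by (intro ellQ_relation lowered_in_slit n) auto
  ultimately show ?thesis
    by (simp only: LIMSEQ_const_iff)
qed

text \<open>Limit of derivatives: the functions shifted downwards are differentiable by the formula
  on \<open>slit\<close> and converge pointwise to \<open>ellP\<close>. Their derivatives converge
  uniformly, since \<open>ellQ\<close> and \<open>ellR\<close> are uniformly continuous on a compact
  set reaching up to the cut. The limit is a derivative relative to the closed lower half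
  plane.\<close>

lemma ellP_has_derivative_lower:
  assumes m: "Im m \<le> 0" "1 < Re m" and n: "n \<in> slit" and nm: "n \<noteq> m"
  obtains r where "r > 0"
    "((\<lambda>w. ellP (fst w) (snd w)) has_derivative (\<lambda>h. ellQ n m * fst h + ellR n m * snd h))
       (at (n, m) within cball n r \<times> (cball m r \<inter> {m. Im m \<le> 0}))"
proof -
  obtain r1 where r1: "r1 > 0" "cball n r1 \<subseteq> slit"
    using open_slit n by (meson open_contains_cball)
  \<comment> \<open>On \<open>T\<close> below, the arguments move by at most \<open>r\<close> and
    \<open>2 * r\<close>. The second bound keeps them distinct there, and the third keeps real parts
    of the modulus above \<open>b = 1 + 2 * r\<close>.\<close>
  define r where "r = min r1 (min (dist n m / 4) ((Re m - 1) / 4))"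
  have r: "r > 0" "r \<le> r1" "4 * r \<le> dist n m" "4 * r \<le> Re m - 1"
  proof -
    have "dist n m > 0" using nm by simp
    then show "r > 0" using r1 m by (simp add: r_def)
    have "r \<le> (Re m - 1) / 4" unfolding r_def by (intro min.coboundedI2 order_refl)
    then show "4 * r \<le> Re m - 1" by simp
    show "r \<le> r1" "4 * r \<le> dist n m" unfolding r_def by linarith+
  qed
  define b where "b = 1 + 2 * r"
  define S where "S = cball n r \<times> (cball m r \<inter> {m. Im m \<le> 0})"
  \<comment> \<open>The doubled radius leaves room for the downward shifts of points of
    \<open>S\<close>, whose length is at most \<open>r\<close>.\<close>
  define T where "T = cball n r \<times> (cball m (2 * r) \<inter> {m. Im m \<le> 0})"
  have b: "b > 1" using r by (simp add: b_def)
  have cn: "cball n r \<subseteq> slit" using r r1 by (meson subset_cball order_trans)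
  have Re_ge: "b \<le> Re m'" if "m' \<in> cball m (2 * r)" for m'
  proof -
    have "\<bar>Re m - Re m'\<bar> \<le> 2 * r"
      using abs_Re_le_cmod[of "m - m'"] that by (simp add: dist_norm)
    then show ?thesis using r by (simp add: b_def)
  qed
  have T_sub: "T \<subseteq> cball n r \<times> {m. Im m \<le> 0 \<and> b \<le> Re m}"
    using Re_ge by (auto simp: T_def)
  have neqT: "fst w \<noteq> snd w" if "w \<in> T" for w
  proof
    assume "fst w = snd w"
    then have "dist n (fst w) \<le> r" "dist m (fst w) \<le> 2 * r"
      using that by (auto simp: T_def)
    then have "dist n m \<le> 3 * r" using dist_triangle2[of n m "fst w"] by linarith
    then show False using r by linarith
  qed
  have P_T: "continuous_on T (\<lambda>w. ellP (fst w) (snd w))"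
    and Q_T: "continuous_on T (\<lambda>w. ellQ (fst w) (snd w))"
    by (intro continuous_on_subset[OF _ T_sub] continuous_on_ellP_lower continuous_on_ellQ_lower
        compact_cball cn b)+
  have E_T: "continuous_on T (\<lambda>w. ellE (snd w))"
    by (rule continuous_on_compose2[OF continuous_on_ellE_lower]) (auto simp: T_def intro!: continuous_intros)
  have "1 - snd w \<noteq> 0" if "w \<in> T" for w
    using that T_sub b by (auto simp: complex_eq_iff)
  then have R_T: "continuous_on T (\<lambda>w. ellR (fst w) (snd w))"
    unfolding ellR_def using neqT by (intro continuous_intros P_T E_T) auto
  have "compact T" unfolding T_def
    by (intro compact_Times compact_cball compact_Int_closed closed_halfspace_Im_le)
  then have unif: "uniformly_continuous_on T (\<lambda>w. ellQ (fst w) (snd w))"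
      "uniformly_continuous_on T (\<lambda>w. ellR (fst w) (snd w))"
    using Q_T R_T by (auto intro: compact_uniformly_continuous)
  have S_T: "S \<subseteq> T" using r by (auto simp: S_def T_def)
  let ?l = "\<lambda>k w. (fst w, lowered (snd w) r k)"
  have l_T: "?l k w \<in> T" if "w \<in> S" for k w
  proof -
    have "dist m (lowered (snd w) r k) \<le> dist m (snd w) + dist (lowered (snd w) r k) (snd w)"
      by (rule dist_triangle2)
    also have "dist (lowered (snd w) r k) (snd w) = r / real (Suc k)"
      using r by (simp add: dist_lowered)
    also have "\<dots> \<le> r" using r by (simp add: field_simps)
    finally show ?thesis using that r Im_lowered_le[of "snd w" r k] by (auto simp: S_def T_def)
  qed
  have l_lim: "(\<lambda>k. ?l k w) \<longlonglongrightarrow> w" for w :: "complex \<times> complex"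
    using tendsto_Pair[OF tendsto_const lowered_tendsto[of "snd w" r], of "fst w"] by simp
  have lim: "(\<lambda>k. ellP (fst (?l k w)) (snd (?l k w))) \<longlonglongrightarrow> ellP (fst w) (snd w)" if "w \<in> S" for w
    using continuous_on_tendsto_compose[OF P_T l_lim[of w]] l_T[OF that] S_T that by auto
  have nmS: "(n, m) \<in> S" using r m by (simp add: S_def)
  define f' where "f' = (\<lambda>w h. ellQ (fst w) (snd w) * fst h + ellR (fst w) (snd w) * snd h)"
  have "\<exists>g. \<forall>w\<in>S. (\<lambda>k. ellP (fst (?l k w)) (snd (?l k w))) \<longlonglongrightarrow> g w \<and> (g has_derivative f' w) (at w within S)"
  proof (rule has_derivative_sequence[where f = "\<lambda>k w. ellP (fst (?l k w)) (snd (?l k w))"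
        and f' = "\<lambda>k w. f' (?l k w)" and ?x0.0 = "(n, m)"])
    show "(n, m) \<in> S" by (rule nmS)
    show "(\<lambda>k. ellP (fst (?l k (n, m))) (snd (?l k (n, m)))) \<longlonglongrightarrow> ellP (fst (n, m)) (snd (n, m))"
      by (rule lim[OF nmS])
  next
    show "convex S"
      unfolding S_def by (intro convex_Times convex_Int convex_cball convex_halfspace_Im_le)
  next
    fix k w assume w: "w \<in> S"
    have 1: "(?l k has_derivative (\<lambda>h. h)) (at w within S)"
      unfolding lowered_def by (auto intro!: derivative_eq_intros)
    have "((\<lambda>w. ellP (fst w) (snd w)) has_derivative f' (?l k w)) (at (?l k w))"
      unfolding f'_def fst_conv snd_conv using w cn r neqT[OF l_T[OF w, of k]]
      by (intro ellP_has_derivative_slit lowered_in_slit) (auto simp: S_def)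
    from has_derivative_compose[OF 1 this]
    show "((\<lambda>w. ellP (fst (?l k w)) (snd (?l k w))) has_derivative f' (?l k w)) (at w within S)"
      by simp
  next
    fix e :: real assume e: "e > 0"
    obtain d1 where d1: "d1 > 0" "\<And>w w'. w \<in> T \<Longrightarrow> w' \<in> T \<Longrightarrow> dist w' w < d1 \<Longrightarrow>
        dist (ellQ (fst w') (snd w')) (ellQ (fst w) (snd w)) < e / 2"
      using unif(1) e unfolding uniformly_continuous_on_def by (metis half_gt_zero)
    obtain d2 where d2: "d2 > 0" "\<And>w w'. w \<in> T \<Longrightarrow> w' \<in> T \<Longrightarrow> dist w' w < d2 \<Longrightarrow>
        dist (ellR (fst w') (snd w')) (ellR (fst w) (snd w)) < e / 2"
      using unif(2) e unfolding uniformly_continuous_on_def by (metis half_gt_zero)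
    have "(\<lambda>k. r * inverse (real (Suc k))) \<longlonglongrightarrow> r * 0"
      by (intro tendsto_intros LIMSEQ_inverse_real_of_nat)
    then have "\<forall>\<^sub>F k in sequentially. r * inverse (real (Suc k)) < min d1 d2"
      using d1 d2 by (intro order_tendstoD) auto
    then show "\<forall>\<^sub>F k in sequentially. \<forall>w\<in>S. \<forall>h. norm (f' (?l k w) h - f' w h) \<le> e * norm h"
    proof eventually_elim
      case (elim k)
      show ?case
      proof (intro ballI allI)
        fix w h :: "complex \<times> complex" assume w: "w \<in> S"
        have d: "dist (?l k w) w < min d1 d2"
          using elim r dist_lowered[of r "snd w" k] by (cases w) (simp add: dist_Pair_Pair divide_inverse)
        have q: "cmod (ellQ (fst (?l k w)) (snd (?l k w)) - ellQ (fst w) (snd w)) \<le> e / 2"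
          using d1(2)[of w "?l k w"] d w S_T l_T by (force simp: dist_norm)
        have s: "cmod (ellR (fst (?l k w)) (snd (?l k w)) - ellR (fst w) (snd w)) \<le> e / 2"
          using d2(2)[of w "?l k w"] d w S_T l_T by (force simp: dist_norm)
        have h: "norm (fst h) \<le> norm h" "norm (snd h) \<le> norm h"
          using norm_fst_le[of "fst h" "snd h"] norm_snd_le[of "snd h" "fst h"] by simp_all
        have "f' (?l k w) h - f' w h =
            (ellQ (fst (?l k w)) (snd (?l k w)) - ellQ (fst w) (snd w)) * fst h +
            (ellR (fst (?l k w)) (snd (?l k w)) - ellR (fst w) (snd w)) * snd h"
          by (simp add: f'_def algebra_simps)
        also have "norm \<dots> \<le> e / 2 * norm h + e / 2 * norm h"
          by (intro norm_triangle_le add_mono)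
             (auto simp only: norm_mult intro!: mult_mono h q s norm_ge_zero less_imp_le[OF half_gt_zero[OF e]])
        finally show "norm (f' (?l k w) h - f' w h) \<le> e * norm h" by simp
      qed
    qed
  qed
  then obtain g where g: "\<And>w. w \<in> S \<Longrightarrow> (\<lambda>k. ellP (fst (?l k w)) (snd (?l k w))) \<longlonglongrightarrow> g w"
      "\<And>w. w \<in> S \<Longrightarrow> (g has_derivative f' w) (at w within S)" by blast
  have "g w = ellP (fst w) (snd w)" if "w \<in> S" for w
    using LIMSEQ_unique[OF g(1)[OF that] lim[OF that]] .
  then have "((\<lambda>w. ellP (fst w) (snd w)) has_derivative f' (n, m)) (at (n, m) within S)"
    by (intro has_derivative_transform[OF nmS _ g(2)[OF nmS]]) auto
  then show ?thesis
    using r(1) by (intro that[of r]) (simp_all add: S_def f'_def)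
qed

section \<open>The jump of \<open>K\<close> across the cut\<close>

lemma cnj_ellP_0:
  assumes "m \<in> slit"
  shows "cnj (ellP 0 m) = ellP 0 (cnj m)"
proof -
  have "cnj (1 / csqrt (1 - m * sin2 t)) = 1 / csqrt (1 - cnj m * sin2 t)" for t
    using slit_modulus[OF assms, of t] by (simp add: cnj_csqrt sin2_def)
  moreover have "cnj (ellP 0 m) = integral {0..pi/2} (\<lambda>t. cnj (1 / csqrt (1 - m * sin2 t)))"
    unfolding ellP_def by (simp add: integral_cnj)
  ultimately show ?thesis by (simp add: ellP_def)
qed

text \<open>Up to \<open>crit a\<close> the integrand is real. Beyond it the principal root is
  \<open>\<i>\<close> times a positive number below \<open>sqrt a\<close>, so the imaginary part is
  at most \<open>- (1 / sqrt a)\<close> on an interval of positive length.\<close>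

lemma Im_ellP_0_neg:
  assumes a: "1 < a"
  shows "Im (ellP 0 (of_real a)) < 0"
proof -
  define u where "u = crit a"
  have u: "0 < u" "u < pi/2" using crit_bounds[OF a] by (auto simp: u_def)
  have "(\<lambda>t. 1 / csqrt (1 - of_real a * sin2 t)) absolutely_integrable_on {0..pi/2}"
    using a by (intro lower_integrable continuous_intros) auto
  then have "((\<lambda>t. 1 / csqrt (1 - of_real a * sin2 t)) has_integral ellP 0 (of_real a)) {0..pi/2}"
    using set_lebesgue_integral_eq_integral(1) by (auto simp: ellP_def has_integral_integral)
  from has_integral_Im[OF this]
  have 1: "((\<lambda>t. Im (1 / csqrt (1 - of_real a * sin2 t))) has_integral Im (ellP 0 (of_real a))) {0..pi/2}" .
  have "((\<lambda>t. - (1 / sqrt a)) has_integral (- (1 / sqrt a) * (pi/2 - u))) {u..pi/2}"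
    using has_integral_const_real[of "- (1 / sqrt a)" u "pi/2"] u by (simp add: mult.commute)
  then have 2: "((\<lambda>t. if t \<in> {u..pi/2} then - (1 / sqrt a) else 0) has_integral (- (1 / sqrt a) * (pi/2 - u))) {0..pi/2}"
    using u by (subst has_integral_restrict) auto
  have le: "Im (1 / csqrt (1 - of_real a * sin2 t)) \<le> (if t \<in> {u..pi/2} then - (1 / sqrt a) else 0)"
    if t: "t \<in> {0..pi/2} - {u}" for t
  proof -
    have eq: "1 - of_real a * sin2 t = of_real (1 - a * (sin t)\<^sup>2)" by (simp add: sin2_def)
    have su: "a * (sin u)\<^sup>2 = 1" using a by (simp add: u_def sin_crit power_divide)
    show ?thesis
    proof (cases "u \<le> t")
      case True
      then have "sin u < sin t" using t u by (intro sin_monotone_2pi) auto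
      moreover have "0 < sin u" using u by (intro sin_gt_zero) auto
      ultimately have "(sin u)\<^sup>2 < (sin t)\<^sup>2" by (intro power_strict_mono) auto
      then have lt: "1 < a * (sin t)\<^sup>2" using a su by (metis less_trans mult_less_cancel_left_pos zero_less_one)
      have "(sin t)\<^sup>2 \<le> 1" by (simp add: abs_square_le_1)
      then have "a * (sin t)\<^sup>2 \<le> a * 1" using a by (intro mult_left_mono) auto
      then have "1 / sqrt a \<le> 1 / sqrt (a * (sin t)\<^sup>2 - 1)"
        using lt by (intro divide_left_mono) auto
      moreover have "csqrt (1 - of_real a * sin2 t) = \<i> * of_real (sqrt (a * (sin t)\<^sup>2 - 1))"
        unfolding eq using lt by (subst csqrt_of_real_nonpos) auto
      moreover have "Im (1 / (\<i> * of_real s)) = - (1 / s)" for s :: real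
        by (simp add: Im_divide power2_eq_square)
      ultimately show ?thesis using True t by (simp del: Im_divide)
    next
      case False
      then have "sin t \<le> sin u" "0 \<le> sin t" using t u
        by (auto intro!: sin_monotone_2pi_le sin_ge_zero)
      then have "(sin t)\<^sup>2 \<le> (sin u)\<^sup>2" by (rule power_mono)
      then have "a * (sin t)\<^sup>2 \<le> 1" using a su by (metis less_trans mult_le_cancel_left_pos zero_less_one)
      then have "csqrt (1 - of_real a * sin2 t) = of_real (sqrt (1 - a * (sin t)\<^sup>2))"
        unfolding eq by (intro csqrt_of_real) auto
      then show ?thesis using False by (simp add: Im_divide)
    qed
  qed
  have "Im (ellP 0 (of_real a)) \<le> - (1 / sqrt a) * (pi/2 - u)"
  proof (rule has_integral_le)
    \<comment> \<open>At \<open>t = u\<close> division by zero gives the integrand the value 0,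
      which exceeds the comparison function; the point is removed before comparing.\<close>
    have spike: "(f has_integral y) ({0..pi/2} - {u})" if "(f has_integral y) {0..pi/2}"
      for f :: "real \<Rightarrow> real" and y
      using that by (subst has_integral_spike_set_eq[where T = "{0..pi/2}"])
        (auto intro: negligible_subset[of "{u}"])
    show "((\<lambda>t. Im (1 / csqrt (1 - of_real a * sin2 t))) has_integral Im (ellP 0 (of_real a)))
        ({0..pi/2} - {u})"
      by (rule spike[OF 1])
    show "((\<lambda>t. if t \<in> {u..pi/2} then - (1 / sqrt a) else 0) has_integral - (1 / sqrt a) * (pi/2 - u))
        ({0..pi/2} - {u})"
      by (rule spike[OF 2])
  qed (rule le)
  also have "\<dots> < 0" using u a by (simp add: zero_less_mult_iff)
  finally show ?thesis .
qed

text \<open>\<open>K\<close> jumps to its complex conjugate, hence is discontinuous, when the modulus crosses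
  the cut upwards.\<close>

lemma eventually_lower:
  fixes m :: "real \<Rightarrow> complex"
  assumes K: "isCont (\<lambda>x. ellP 0 (m x)) x0" and m: "isCont m x0"
    and m0: "Im (m x0) = 0" "1 < Re (m x0)"
  shows "\<forall>\<^sub>F x in nhds x0. Im (m x) \<le> 0"
proof (rule ccontr)
  assume contr: "\<not> ?thesis"
  \<comment> \<open>This filter approaches \<open>x0\<close> through parameters above the cut. The
    negated claim says exactly that it is nontrivial, so limits along it are unique.\<close>
  define F where "F = inf (nhds x0) (principal {x. Im (m x) > 0})"
  have nt: "F \<noteq> bot"
    using contr by (auto simp: F_def trivial_limit_def eventually_inf_principal not_less)
  have id_lim: "((\<lambda>x. x) \<longlongrightarrow> x0) F" by (simp add: F_def filterlim_def filtermap_ident)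
  have evF: "\<forall>\<^sub>F x in F. Im (m x) > 0" by (simp add: F_def eventually_inf_principal)
  have K_lim: "((\<lambda>x. ellP 0 (m x)) \<longlongrightarrow> ellP 0 (m x0)) F"
    using K id_lim by (rule isCont_tendsto_compose)
  have m_lim: "(m \<longlongrightarrow> m x0) F"
    using m id_lim by (rule isCont_tendsto_compose)
  have cnj_m0: "cnj (m x0) = m x0" using m0 by (simp add: complex_eq_iff)
  have cm: "((\<lambda>x. cnj (m x)) \<longlongrightarrow> m x0) F"
    using tendsto_cnj[OF m_lim] cnj_m0 by simp
  define b where "b = (1 + Re (m x0)) / 2"
  have b: "1 < b" "b < Re (m x0)" using m0 by (auto simp: b_def)
  have "\<forall>\<^sub>F x in F. b < Re (m x)"
    using tendsto_Re[OF m_lim] b(2) by (rule order_tendstoD)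
  with evF have ev: "\<forall>\<^sub>F x in F. (0, cnj (m x)) \<in> {0} \<times> {m. Im m \<le> 0 \<and> b \<le> Re m}"
    by eventually_elim auto
  have "((\<lambda>x. ellP 0 (cnj (m x))) \<longlongrightarrow> ellP 0 (m x0)) F"
    using continuous_on_tendsto_compose[OF continuous_on_ellP_lower[of "{0}" b]
        tendsto_Pair[OF tendsto_const cm] _ ev] zero_in_slit b m0 by simp
  then have "((\<lambda>x. cnj (ellP 0 (cnj (m x)))) \<longlongrightarrow> cnj (ellP 0 (m x0))) F"
    by (rule tendsto_cnj)
  moreover have "\<forall>\<^sub>F x in F. cnj (ellP 0 (cnj (m x))) = ellP 0 (m x)"
    using evF
  proof eventually_elim
    case (elim x)
    then have "cnj (m x) \<in> slit" by (simp add: slit_def)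
    from cnj_ellP_0[OF this] show ?case by simp
  qed
  ultimately have "((\<lambda>x. ellP 0 (m x)) \<longlongrightarrow> cnj (ellP 0 (m x0))) F"
    by (rule Lim_transform_eventually)
  then have "cnj (ellP 0 (m x0)) = ellP 0 (m x0)"
    using tendsto_unique[OF nt _ K_lim] by blast
  then have "Im (ellP 0 (m x0)) = 0" by (simp add: complex_eq_iff)
  moreover have "m x0 = of_real (Re (m x0))" using m0 by (simp add: complex_eq_iff)
  ultimately show False using Im_ellP_0_neg[OF m0(2)] by simp
qed

subsection \<open>Reduction to the trigonometric form, and the differential equation\<close>

lemma csqrt_scale:
  assumes "a \<ge> 0"
  shows "csqrt (of_real (a\<^sup>2) * w) = of_real a * csqrt w"
proof (rule csqrt_unique)
  show "(of_real a * csqrt w)\<^sup>2 = of_real (a\<^sup>2) * w" by (simp add: power_mult_distrib)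
  show "0 < Re (of_real a * csqrt w) \<or> Re (of_real a * csqrt w) = 0 \<and> 0 \<le> Im (of_real a * csqrt w)"
    using csqrt_principal[of w] assms
    by (cases "a = 0") (auto simp: zero_less_mult_iff simp del: csqrt.simps)
qed

text \<open>Substitution of \<open>x = sin t\<close> on the open interval, where the Jacobian
  \<open>cos t\<close> cancels the root of 1 - x^2. The change of variables needs absolute
  integrability, which comes from continuity for \<open>z\<^sup>2\<close> in \<open>slit\<close> and
  from the inverse square root bound for \<open>z\<^sup>2\<close> on the cut.\<close>

lemma ellPi_eq_ellP:
  assumes n: "n \<in> slit" and z: "z\<^sup>2 \<noteq> 1"
  shows "ellPi n z = ellP n (z\<^sup>2)"
proof -
  let ?F = "\<lambda>t. 1 / (1 - n * sin2 t) / csqrt (1 - z\<^sup>2 * sin2 t)"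
  let ?S = "{0<..<pi/2}"
  have "?F absolutely_integrable_on {0..pi/2}"
  proof (cases "z\<^sup>2 \<in> slit")
    case True
    then show ?thesis by (intro slit_absolutely_integrable continuous_on_P_weight n)
  next
    case False
    then have "Im (z\<^sup>2) = 0" "Re (z\<^sup>2) \<noteq> 1" "1 \<le> Re (z\<^sup>2)"
      using z by (auto simp: slit_def complex_eq_iff)
    then show ?thesis by (intro lower_integrable continuous_on_P_weight n) auto
  qed
  then have int: "?F absolutely_integrable_on ?S"
    by (rule set_integrable_subset) auto
  have eq: "\<bar>cos t\<bar> *\<^sub>R ellPi_integrand n z (sin t) = ?F t" if "t \<in> ?S" for t
  proof -
    have c: "cos t > 0" using that by (intro cos_gt_zero) auto
    have "(1 - (of_real (sin t))\<^sup>2) * (1 - z\<^sup>2 * (of_real (sin t))\<^sup>2) =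
        of_real ((cos t)\<^sup>2) * (1 - z\<^sup>2 * sin2 t)"
      by (simp add: sin2_def cos_squared_eq)
    then have "csqrt ((1 - (of_real (sin t))\<^sup>2) * (1 - z\<^sup>2 * (of_real (sin t))\<^sup>2)) =
        of_real (cos t) * csqrt (1 - z\<^sup>2 * sin2 t)"
      using c by (simp only: csqrt_scale less_imp_le)
    then have "ellPi_integrand n z (sin t) = 1 / ((1 - n * sin2 t) * (of_real (cos t) * csqrt (1 - z\<^sup>2 * sin2 t)))"
      by (simp add: ellPi_integrand_def sin2_def)
    then show ?thesis using c by (simp add: scaleR_conv_of_real)
  qed
  have inj: "inj_on sin ?S"
    by (intro strict_mono_on_imp_inj_on strict_mono_onI sin_monotone_2pi) auto
  have img: "sin ` ?S = {0<..<1::real}"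
  proof (intro equalityI subsetI)
    fix x :: real assume "x \<in> sin ` ?S"
    then obtain t where t: "x = sin t" "0 < t" "t < pi/2" by auto
    then have "sin t < sin (pi/2)" by (intro sin_monotone_2pi) auto
    then show "x \<in> {0<..<1}" using t by (auto intro: sin_gt_zero)
  next
    fix x :: real assume x: "x \<in> {0<..<1}"
    then have "arcsin 0 < arcsin x" "arcsin x < arcsin 1"
      using arcsin_less_arcsin[of 0 x] arcsin_less_arcsin[of x 1] by simp_all
    then show "x \<in> sin ` ?S"
      using x by (intro image_eqI[of _ _ "arcsin x"]) auto
  qed
  have int': "(\<lambda>t. \<bar>cos t\<bar> *\<^sub>R ellPi_integrand n z (sin t)) absolutely_integrable_on ?S"
    using int by (subst set_integrable_cong[OF refl refl eq])
  have "integral (sin ` ?S) (ellPi_integrand n z) =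
      integral ?S (\<lambda>t. \<bar>cos t\<bar> *\<^sub>R ellPi_integrand n z (sin t))"
  proof -
    have "(\<lambda>t. \<bar>cos t\<bar> *\<^sub>R ellPi_integrand n z (sin t)) absolutely_integrable_on ?S \<and>
        integral ?S (\<lambda>t. \<bar>cos t\<bar> *\<^sub>R ellPi_integrand n z (sin t)) =
          integral ?S (\<lambda>t. \<bar>cos t\<bar> *\<^sub>R ellPi_integrand n z (sin t)) \<longleftrightarrow>
        ellPi_integrand n z absolutely_integrable_on (sin ` ?S) \<and>
        integral (sin ` ?S) (ellPi_integrand n z) =
          integral ?S (\<lambda>t. \<bar>cos t\<bar> *\<^sub>R ellPi_integrand n z (sin t))"
      by (rule has_absolute_integral_change_of_variables_real[OF _ _ inj])
         (auto intro!: derivative_eq_intros)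
    with int' show ?thesis by blast
  qed
  also have "\<dots> = integral ?S ?F"
    by (intro integral_cong eq)
  finally show ?thesis
    unfolding img ellPi_def ellP_def by (simp add: integral_open_interval_real)
qed

lemma ellK_eq_ellPi: "ellK z = ellPi 0 z"
proof -
  have "ellK_integrand z = ellPi_integrand 0 z"
    by (simp add: fun_eq_iff ellK_integrand_def ellPi_integrand_def)
  then show ?thesis by (simp add: ellK_def ellPi_def)
qed

section \<open>Restrictions forced by integrability\<close>

text \<open>Logarithmic divergence: the integral of \<open>e / (c - x)\<close> up to a cutoff close
  to \<open>c\<close> exceeds any supposed value of the integral of \<open>h\<close>.\<close>

lemma not_integrable_pole:
  fixes h :: "real \<Rightarrow> real"
  assumes "0 < d" "0 < e" and h: "h integrable_on {c-d..c}"
    and ge: "\<And>x. x \<in> {c-d..<c} \<Longrightarrow> e / (c - x) \<le> h x"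
  shows False
proof -
  \<comment> \<open>Since \<open>e / 0 = 0\<close>, the value 0 at \<open>c\<close> extends the
    lower bound to the closed interval.\<close>
  define H where "H = (\<lambda>x. if x = c then 0 else h x)"
  have H: "H integrable_on {c-d..c}"
    using h by (rule integrable_spike_finite[of "{c}", rotated 2]) (auto simp: H_def)
  have H_ge: "e / (c - x) \<le> H x" if "x \<in> {c-d..c}" for x
    using ge[of x] that by (auto simp: H_def)
  have H0: "0 \<le> H x" if "x \<in> {c-d..c}" for x
    using order_trans[OF _ H_ge[OF that], of 0] that \<open>0 < e\<close> by auto
  define I where "I = integral {c-d..c} H"
  \<comment> \<open>Solves \<open>e * (ln d - ln q) = \<bar>I\<bar> + 1\<close>, whose left side is
    the integral of \<open>e / (c - x)\<close> over \<open>{c-d..c-q}\<close>.\<close>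
  define q where "q = d * exp (- ((\<bar>I\<bar> + 1) / e))"
  have q: "0 < q" "q < d" using assms(1,2) by (auto simp: q_def)
  have "((\<lambda>x. e / (c - x)) has_integral (- e * ln (c - (c - q)) - - e * ln (c - (c - d)))) {c-d..c-q}"
  proof (rule fundamental_theorem_of_calculus)
    show "c - d \<le> c - q" using q by simp
    fix x assume "x \<in> {c-d..c-q}"
    then have "c - x > 0" using q by auto
    then show "((\<lambda>x. - e * ln (c - x)) has_vector_derivative e / (c - x)) (at x within {c-d..c-q})"
      unfolding has_real_derivative_iff_has_vector_derivative[symmetric]
      by (auto intro!: derivative_eq_intros)
  qed
  moreover have "- e * ln (c - (c - q)) - - e * ln (c - (c - d)) = \<bar>I\<bar> + 1"
  proof -
    have "ln q = ln d - (\<bar>I\<bar> + 1) / e"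
      using assms(1) by (simp add: q_def ln_mult)
    then show ?thesis using assms(2) by (simp add: field_simps)
  qed
  ultimately have 1: "((\<lambda>x. e / (c - x)) has_integral (\<bar>I\<bar> + 1)) {c-d..c-q}" by simp
  have Hq: "H integrable_on {c-d..c-q}"
    by (rule integrable_on_subinterval[OF H]) (use q in auto)
  have "\<bar>I\<bar> + 1 \<le> integral {c-d..c-q} H"
    by (rule has_integral_le[OF 1 integrable_integral[OF Hq]]) (use H_ge q in auto)
  also have "\<dots> \<le> I"
    unfolding I_def by (rule integral_subset_le[OF _ Hq H]) (use H0 q in auto)
  finally show False by simp
qed

text \<open>For \<open>z\<^sup>2 = 1\<close> the integrand on the half-open interval is the
  reciprocal of 1 - x^2, with a simple pole at the endpoint 1.\<close>

lemma ellK_integrable_imp: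
  assumes "ellK_integrand z integrable_on {0..1}"
  shows "z\<^sup>2 \<noteq> 1"
proof
  assume z: "z\<^sup>2 = 1"
  have "(\<lambda>x. Re (ellK_integrand z x)) integrable_on {1-1..1}"
    using has_integral_Re[OF integrable_integral[OF assms]] by (auto simp: integrable_on_def)
  then show False
  proof (rule not_integrable_pole[of 1 "1/2", rotated 2])
    fix x :: real assume x: "x \<in> {1-1..<1}"
    then have x2: "x\<^sup>2 < 1" by (simp add: abs_square_less_1)
    have "(1 - (of_real x)\<^sup>2) * (1 - z\<^sup>2 * (of_real x)\<^sup>2) = of_real ((1 - x\<^sup>2)\<^sup>2) * 1"
      unfolding z by (simp add: power2_eq_square)
    then have "csqrt ((1 - (of_real x)\<^sup>2) * (1 - z\<^sup>2 * (of_real x)\<^sup>2)) = of_real (1 - x\<^sup>2) * csqrt 1"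
      using x2 by (simp only: csqrt_scale)
    then have "ellK_integrand z x = of_real (1 / (1 - x\<^sup>2))" by (simp add: ellK_integrand_def)
    moreover have "(1/2) / (1 - x) \<le> 1 / (1 - x\<^sup>2)"
    proof -
      have "1 - x\<^sup>2 = (1 - x) * (1 + x)" by (simp add: power2_eq_square algebra_simps)
      also have "\<dots> \<le> (1 - x) * 2" using x by (intro mult_left_mono) auto
      finally have "1 / (2 * (1 - x)) \<le> 1 / (1 - x\<^sup>2)" using x2 by (intro divide_left_mono) auto
      then show ?thesis by simp
    qed
    ultimately show "(1/2) / (1 - x) \<le> Re (ellK_integrand z x)" by (simp only: Re_complex_of_real)
  qed auto
qed

text \<open>For \<open>Im m \<le> 0\<close> the radicand stays in the closed upper half plane, where
  the principal root is the continuous \<open>usqrt\<close>. For \<open>Im m > 0\<close> it is not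
  real at \<open>x0\<close>.\<close>

lemma isCont_csqrt_modulus:
  fixes x0 :: real
  assumes "0 < x0" "1 - m * (of_real x0)\<^sup>2 \<noteq> 0"
  shows "isCont (\<lambda>x. csqrt (1 - m * (of_real x)\<^sup>2)) x0"
proof (cases "Im m \<le> 0")
  case True
  have "Im (1 - m * (of_real x)\<^sup>2) \<ge> 0" for x :: real
    using True by (simp add: mult_nonpos_nonneg flip: of_real_power)
  then have "(\<lambda>x. csqrt (1 - m * (of_real x)\<^sup>2)) = (\<lambda>x::real. usqrt (1 - m * (of_real x)\<^sup>2))"
    by (simp only: usqrt_eq_csqrt)
  moreover have "continuous_on UNIV (\<lambda>x::real. usqrt (1 - m * (of_real x)\<^sup>2))"
    by (intro continuous_intros)
  ultimately show ?thesis by (simp add: continuous_on_eq_continuous_at)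
next
  case False
  then have "Im (1 - m * (of_real x0)\<^sup>2) \<noteq> 0"
    using assms(1) by (simp flip: of_real_power)
  then have "1 - m * (of_real x0)\<^sup>2 \<notin> \<real>\<^sub>\<le>\<^sub>0" by (auto simp: complex_nonpos_Reals_iff)
  then show ?thesis by (intro isCont_csqrt' continuous_intros)
qed

text \<open>For real \<open>n > 1\<close> the factor 1 - n x^2 has a simple zero \<open>c\<close>
  inside the interval, while the remaining factor \<open>\<phi>\<close> is continuous and nonzero at
  \<open>c\<close> because \<open>z\<^sup>2 \<noteq> n\<close>. Multiplication by
  \<open>cnj (\<phi> c)\<close> makes the real part of that factor positive near \<open>c\<close>,
  which gives a one-sided real pole.\<close>

lemma ellPi_integrable_imp:
  assumes int: "ellPi_integrand n z integrable_on {0..1}" and n1: "n \<noteq> 1" and nz: "z\<^sup>2 \<noteq> n"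
  shows "n \<in> slit"
proof (rule ccontr)
  assume "n \<notin> slit"
  then have "Im n = 0" "Re n > 1" using n1 by (auto simp: slit_def complex_eq_iff)
  then obtain a where a: "n = of_real a" "a > 1" by (metis complex_is_Real_iff of_real_Re)
  define c where "c = 1 / sqrt a"
  have c: "0 < c" "c < 1" and ac: "a * c\<^sup>2 = 1" using a by (auto simp: c_def power_divide)
  have c2: "c\<^sup>2 < 1" using c by (simp add: abs_square_less_1)
  define \<phi> where "\<phi> = (\<lambda>x::real. 1 / (of_real (sqrt (1 - x\<^sup>2)) * csqrt (1 - z\<^sup>2 * (of_real x)\<^sup>2)))"
  have nz': "1 - z\<^sup>2 * (of_real c)\<^sup>2 \<noteq> 0"
  proof
    assume "1 - z\<^sup>2 * (of_real c)\<^sup>2 = 0"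
    moreover have "of_real a * of_real (c\<^sup>2) = (1::complex)"
      by (metis ac of_real_1 of_real_mult)
    ultimately have "z\<^sup>2 * of_real (c\<^sup>2) = of_real a * of_real (c\<^sup>2)"
      by simp
    then show False using nz a c by simp
  qed
  have \<phi>_eq: "ellPi_integrand n z x = of_real (1 / (1 - a * x\<^sup>2)) * \<phi> x" if "\<bar>x\<bar> < 1" for x
  proof -
    have "1 - x\<^sup>2 \<ge> 0" using that by (simp add: abs_square_le_1)
    then have "(1 - (of_real x)\<^sup>2) * (1 - z\<^sup>2 * (of_real x)\<^sup>2) =
        of_real ((sqrt (1 - x\<^sup>2))\<^sup>2) * (1 - z\<^sup>2 * (of_real x)\<^sup>2)"
      by simp
    then have "csqrt ((1 - (of_real x)\<^sup>2) * (1 - z\<^sup>2 * (of_real x)\<^sup>2)) =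
        of_real (sqrt (1 - x\<^sup>2)) * csqrt (1 - z\<^sup>2 * (of_real x)\<^sup>2)"
      by (simp only: csqrt_scale real_sqrt_ge_zero \<open>1 - x\<^sup>2 \<ge> 0\<close>)
    then show ?thesis by (simp add: ellPi_integrand_def \<phi>_def a)
  qed
  have "isCont \<phi> c"
    unfolding \<phi>_def using c2 nz' c(1) by (intro continuous_intros isCont_csqrt_modulus) auto
  then have "isCont (\<lambda>x. Re (\<phi> x * cnj (\<phi> c))) c"
    unfolding isCont_def by (intro tendsto_intros)
  moreover have \<phi>0: "\<phi> c \<noteq> 0" using c2 nz' by (simp add: \<phi>_def)
  define \<kappa> where "\<kappa> = (cmod (\<phi> c))\<^sup>2"
  have \<kappa>: "\<kappa> > 0" using \<phi>0 by (simp add: \<kappa>_def)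
  have "Re (\<phi> c * cnj (\<phi> c)) = \<kappa>"
    by (simp add: \<kappa>_def complex_mult_cnj cmod_power2)
  ultimately obtain d0 where d0: "d0 > 0" "\<And>x. \<bar>x - c\<bar> < d0 \<Longrightarrow> \<bar>Re (\<phi> x * cnj (\<phi> c)) - \<kappa>\<bar> < \<kappa> / 2"
    using \<kappa> unfolding continuous_at_eps_delta dist_real_def by (metis half_gt_zero)
  define d where "d = min (d0 / 2) c"
  have d: "0 < d" "d < d0" "d \<le> c" using d0 c by (auto simp: d_def)
  have "ellPi_integrand n z integrable_on {c-d..c}"
    by (rule integrable_on_subinterval[OF int]) (use d c in auto)
  then have "(\<lambda>x. ellPi_integrand n z x * cnj (\<phi> c)) integrable_on {c-d..c}"
    by (rule integrable_on_mult_left)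
  then have "(\<lambda>x. Re (ellPi_integrand n z x * cnj (\<phi> c))) integrable_on {c-d..c}"
    using has_integral_Re by (metis integrable_on_def)
  then show False
  \<comment> \<open>The constant combines 1 - a x^2 \<le> 2 a c (c - x) with the lower bound
    \<open>\<kappa> / 2\<close> for the real part of
    \<open>\<phi> x * cnj (\<phi> c)\<close>.\<close>
  proof (rule not_integrable_pole[of d "\<kappa> / (4 * a * c)", rotated 2])
    fix x assume x: "x \<in> {c-d..<c}"
    have x1: "0 \<le> x" "\<bar>x\<bar> < 1" using x d c by auto
    have "\<bar>Re (\<phi> x * cnj (\<phi> c)) - \<kappa>\<bar> < \<kappa> / 2" using x d by (intro d0) auto
    then have ge: "Re (\<phi> x * cnj (\<phi> c)) \<ge> \<kappa> / 2" by linarith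
    have "1 - a * x\<^sup>2 = a * (c - x) * (c + x)"
      using ac by (simp add: power2_eq_square algebra_simps)
    also have "\<dots> \<le> a * (c - x) * (2 * c)"
      using a x by (intro mult_left_mono) auto
    finally have up: "1 - a * x\<^sup>2 \<le> 2 * a * c * (c - x)" by (simp add: algebra_simps)
    have pos: "1 - a * x\<^sup>2 > 0"
      using \<open>1 - a * x\<^sup>2 = a * (c - x) * (c + x)\<close> a x c x1 by simp
    have "\<kappa> / (4 * a * c) / (c - x) = 1 / (2 * a * c * (c - x)) * (\<kappa> / 2)"
      by simp
    also have "\<dots> \<le> 1 / (1 - a * x\<^sup>2) * Re (\<phi> x * cnj (\<phi> c))"
      using up pos ge \<kappa> by (intro mult_mono divide_left_mono mult_pos_pos) (use a c x in auto)
    also have "\<dots> = Re (of_real (1 / (1 - a * x\<^sup>2)) * (\<phi> x * cnj (\<phi> c)))"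
      by (simp only: scaleR_complex.sel flip: scaleR_conv_of_real)
    also have "\<dots> = Re (ellPi_integrand n z x * cnj (\<phi> c))"
      by (simp only: \<phi>_eq[OF x1(2)] mult.assoc)
    finally show "\<kappa> / (4 * a * c) / (c - x) \<le> Re (ellPi_integrand n z x * cnj (\<phi> c))" .
  qed (use d \<kappa> a c in auto)
qed

section \<open>Differentiation along the curve\<close>

text \<open>Chain rule. On the cut the outer derivative exists only relative to the lower half
  plane, and \<open>low\<close> ensures that a whole neighbourhood of \<open>x\<close> is mapped
  into the set where it is available.\<close>

lemma ellP_path_derivative:
  fixes n m :: "real \<Rightarrow> complex"
  assumes n: "(n has_vector_derivative n') (at x)" and m: "(m has_vector_derivative m') (at x)"
    and nx: "n x \<in> slit" and mx: "m x \<noteq> 1" and nm: "n x \<noteq> m x"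
    and low: "m x \<notin> slit \<Longrightarrow> \<forall>\<^sub>F y in nhds x. Im (m y) \<le> 0"
  shows "((\<lambda>y. ellP (n y) (m y)) has_vector_derivative
            (ellQ (n x) (m x) * n' + ellR (n x) (m x) * m')) (at x)"
proof -
  have path: "((\<lambda>y. (n y, m y)) has_derivative (\<lambda>h. (h *\<^sub>R n', h *\<^sub>R m'))) (at x)"
    using n m unfolding has_vector_derivative_def by (rule has_derivative_Pair)
  let ?D = "\<lambda>h. ellQ (n x) (m x) * fst h + ellR (n x) (m x) * snd h"
  obtain S where S: "((\<lambda>w. ellP (fst w) (snd w)) has_derivative ?D) (at (n x, m x) within S)"
      and ev: "\<forall>\<^sub>F y in nhds x. (n y, m y) \<in> S"
  proof (cases "m x \<in> slit")
    case True
    then show ?thesis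
      using that[of UNIV] ellP_has_derivative_slit[OF True nx nm] by simp
  next
    case False
    then have mx': "Im (m x) \<le> 0" "1 < Re (m x)"
      using mx by (auto simp: slit_def complex_eq_iff)
    obtain r where r: "r > 0" "((\<lambda>w. ellP (fst w) (snd w)) has_derivative ?D)
        (at (n x, m x) within cball (n x) r \<times> (cball (m x) r \<inter> {m. Im m \<le> 0}))"
      using ellP_has_derivative_lower[OF mx' nx nm] by blast
    have "(n \<longlongrightarrow> n x) (nhds x)" "(m \<longlongrightarrow> m x) (nhds x)"
      using n m by (auto dest: has_vector_derivative_continuous simp: isCont_def tendsto_at_iff_tendsto_nhds)
    then have "\<forall>\<^sub>F y in nhds x. n y \<in> ball (n x) r" "\<forall>\<^sub>F y in nhds x. m y \<in> ball (m x) r"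
      using r(1) by (auto intro: topological_tendstoD[OF _ open_ball] simp del: mem_ball simp: centre_in_ball)
    then have "\<forall>\<^sub>F y in nhds x. (n y, m y) \<in> cball (n x) r \<times> (cball (m x) r \<inter> {m. Im m \<le> 0})"
      using low[OF False] by eventually_elim auto
    with r(2) show ?thesis by (rule that)
  qed
  obtain T where T: "open T" "x \<in> T" "\<And>y. y \<in> T \<Longrightarrow> (n y, m y) \<in> S"
    using ev unfolding eventually_nhds by blast
  have "((\<lambda>w. ellP (fst w) (snd w)) has_derivative ?D) (at (n x, m x) within (\<lambda>y. (n y, m y)) ` T)"
    by (rule has_derivative_subset[OF S]) (use T in auto)
  from has_derivative_in_compose[OF has_derivative_at_withinI[OF path, of T] this]
  have "((\<lambda>y. ellP (n y) (m y)) has_derivative (\<lambda>h. ?D (h *\<^sub>R n', h *\<^sub>R m'))) (at x within T)"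
    by simp
  then have "((\<lambda>y. ellP (n y) (m y)) has_derivative (\<lambda>h. ?D (h *\<^sub>R n', h *\<^sub>R m'))) (at x)"
    by (simp add: at_within_open[OF T(2,1)])
  then show ?thesis
    unfolding has_vector_derivative_def by (simp add: scaleR_add_right)
qed

text \<open>Pure algebra: after \<open>Q\<close> is eliminated, both sides are linear in the symbols
  \<open>E\<close>, \<open>P\<close> and \<open>K\<close>, and the coefficients are compared. The
  last summand on the left is \<open>r\<close> times the derivative of the first kind, which is the
  case \<open>n = 0\<close> of \<open>ellR\<close>.\<close>

lemma elliptic_combination_derivative:
  fixes n q :: complex
  assumes nz: "n \<noteq> 0" "n \<noteq> 1" "q \<noteq> 0" "q' \<noteq> 0" "q\<^sup>2 \<noteq> n" "q\<^sup>2 \<noteq> 1"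
    and r: "r = (n' * q * (1 - q\<^sup>2) + 2 * q' * q\<^sup>2 * (n - 1)) / (2 * q' * (1 - n) * (q\<^sup>2 - n))"
    and f: "f = (n' * (n\<^sup>2 - q\<^sup>2) - 2 * q' * q * n * (n - 1)) / (2 * n * (n - 1) * (q\<^sup>2 - n))"
    and ode: "r' - (f + q' / q) * r = - (n' / (2 * n * (n - 1)))"
    and Q: "2 * n * (n - 1) * (n - q\<^sup>2) * Q + n * E + (q\<^sup>2 - n) * K + (n\<^sup>2 - q\<^sup>2) * P = 0"
  shows "Q * n' + (P - E / (1 - q\<^sup>2)) / (2 * (n - q\<^sup>2)) * (2 * q * q') + r' * K
          + r * ((K - E / (1 - q\<^sup>2)) / (2 * (0 - q\<^sup>2)) * (2 * q * q')) = f * (P + r * K)"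
proof -
  have d: "n - 1 \<noteq> 0" "1 - n \<noteq> 0" "q\<^sup>2 - n \<noteq> 0" "n - q\<^sup>2 \<noteq> 0" "1 - q\<^sup>2 \<noteq> 0" using nz by auto
  \<comment> \<open>Treating the denominators as atoms \<open>k\<close>, \<open>l\<close>,
    \<open>j\<close> allows fractions to be cleared without expanding them.\<close>
  define k where "k = q\<^sup>2 - n"
  define l where "l = n - 1"
  define j where "j = 1 - q\<^sup>2"
  have kl: "k \<noteq> 0" "l \<noteq> 0" "j \<noteq> 0" "n - q\<^sup>2 = - k" "1 - n = - l" using d by (auto simp: k_def l_def j_def)
  have Q': "Q = (n * E + k * K + (n\<^sup>2 - q\<^sup>2) * P) / (2 * n * l * k)"
    using Q kl nz unfolding kl k_def[symmetric] l_def[symmetric]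
    by (simp add: field_simps)
  have r': "r' = (f + q' / q) * r - n' / (2 * n * l)"
    using ode by (simp add: l_def algebra_simps)
  have rr: "r = - ((n' * q * j + 2 * q' * q\<^sup>2 * l) / (2 * q' * l * k))"
    unfolding r k_def[symmetric] j_def[symmetric] l_def[symmetric] kl(5) by simp
  have ff: "f = n' * (n\<^sup>2 - q\<^sup>2) / (2 * n * l * k) - q' * q / k"
    unfolding f k_def[symmetric] l_def[symmetric] using kl nz by (simp add: field_simps)
  \<comment> \<open>The coefficient of \<open>E\<close>; the prescribed \<open>r\<close> is the
    solution of this linear equation.\<close>
  have E: "n' / (2 * l * k) + q * q' / (j * k) + r * q' / (q * j) = 0"
    unfolding rr using kl nz by (simp add: field_simps power2_eq_square)
  have "Q * n' + (P - E / j) / (2 * (- k)) * (2 * q * q') + r' * K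
          + r * ((K - E / j) / (2 * (0 - q\<^sup>2)) * (2 * q * q')) =
      (n' / (2 * l * k) + q * q' / (j * k) + r * q' / (q * j)) * E
      + (n' * (n\<^sup>2 - q\<^sup>2) / (2 * n * l * k) - q' * q / k) * P
      + (n' / (2 * n * l) + r' - r * q' / q) * K"
    unfolding Q' using kl nz by (simp add: field_simps power2_eq_square)
  also have "\<dots> = f * P + f * r * K"
    unfolding E ff[symmetric] r' by (simp add: algebra_simps)
  finally show ?thesis by (simp add: kl j_def algebra_simps)
qed

theorem theorem7:
  fixes A :: "real set"
    and p q p' q' r r' f F :: "real \<Rightarrow> complex"
  assumes A: "open A"
    and p: "\<And>x. x \<in> A \<Longrightarrow> (p has_vector_derivative p' x) (at x)"
    and q: "\<And>x. x \<in> A \<Longrightarrow> (q has_vector_derivative q' x) (at x)"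
    and p_nonzero: "\<And>x. x \<in> A \<Longrightarrow> p x \<noteq> 0"
    and p_neq_1: "\<And>x. x \<in> A \<Longrightarrow> p x \<noteq> 1"
    and q_nonzero: "\<And>x. x \<in> A \<Longrightarrow> q x \<noteq> 0"
    and q'_nonzero: "\<And>x. x \<in> A \<Longrightarrow> q' x \<noteq> 0"
    and q_sq_neq_p: "\<And>x. x \<in> A \<Longrightarrow> (q x)\<^sup>2 \<noteq> p x"
    and r: "\<And>x. x \<in> A \<Longrightarrow>
        r x = (p' x * q x * (1 - (q x)\<^sup>2) + 2 * q' x * (q x)\<^sup>2 * (p x - 1)) /
              (2 * q' x * (1 - p x) * ((q x)\<^sup>2 - p x))"
    and f: "\<And>x. x \<in> A \<Longrightarrow>
        f x = (p' x * ((p x)\<^sup>2 - (q x)\<^sup>2) - 2 * q' x * q x * p x * (p x - 1)) /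
              (2 * p x * (p x - 1) * ((q x)\<^sup>2 - p x))"
    and r_deriv: "\<And>x. x \<in> A \<Longrightarrow> (r has_vector_derivative r' x) (at x)"
    and ode: "\<And>x. x \<in> A \<Longrightarrow>
        r' x - (f x + q' x / q x) * r x = - (p' x / (2 * p x * (p x - 1)))"
    and Pi_defined: "\<And>x. x \<in> A \<Longrightarrow> ellPi_integrand (p x) (q x) integrable_on {0..1}"
    and Pi_diff: "(\<lambda>x. ellPi (p x) (q x)) differentiable_on A"
    and K_defined: "\<And>x. x \<in> A \<Longrightarrow> ellK_integrand (q x) integrable_on {0..1}"
    and K_diff: "(\<lambda>x. ellK (q x)) differentiable_on A"
    and F: "\<And>x. x \<in> A \<Longrightarrow> (F has_vector_derivative f x) (at x)"
  shows "\<exists>C :: real \<Rightarrow> complex.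
           (\<forall>S \<in> components A. C constant_on S) \<and>
           (\<forall>x \<in> A. ellPi (p x) (q x) + r x * ellK (q x) = C x * exp (F x))"
proof -
  define m where "m = (\<lambda>x. (q x)\<^sup>2)"
  define W where "W = (\<lambda>x. ellPi (p x) (q x) + r x * ellK (q x))"
  have m1: "m x \<noteq> 1" if "x \<in> A" for x
    unfolding m_def using that by (intro ellK_integrable_imp K_defined)
  have p_slit: "p x \<in> slit" if "x \<in> A" for x
    using that Pi_defined p_neq_1 q_sq_neq_p by (intro ellPi_integrable_imp[of "p x" "q x"]) auto
  have Pi_eq: "ellPi (p x) (q x) = ellP (p x) (m x)"
    and K_eq: "ellK (q x) = ellP 0 (m x)" if "x \<in> A" for x
    using that m1 p_slit zero_in_slit by (simp_all add: ellK_eq_ellPi ellPi_eq_ellP m_def)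
  have m: "(m has_vector_derivative 2 * q x * q' x) (at x)" if "x \<in> A" for x
    using has_vector_derivative_mult[OF q[OF that] q[OF that]]
    by (simp add: m_def power2_eq_square mult.commute[of "q' x"] mult.assoc)
  have low: "\<forall>\<^sub>F y in nhds x. Im (m y) \<le> 0" if x: "x \<in> A" and "m x \<notin> slit" for x
  proof (rule eventually_lower)
    have "(\<lambda>x. ellK (q x)) differentiable_on A" by (rule K_diff)
    then have "continuous_on A (\<lambda>x. ellK (q x))" by (rule differentiable_imp_continuous_on)
    then have "continuous_on A (\<lambda>x. ellP 0 (m x))" using K_eq by (simp cong: continuous_on_cong)
    then show "isCont (\<lambda>x. ellP 0 (m x)) x"
      using A x by (simp add: continuous_on_eq_continuous_at)
    show "isCont m x" using m[OF x] by (rule has_vector_derivative_continuous)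
    show "Im (m x) = 0" "1 < Re (m x)"
      using \<open>m x \<notin> slit\<close> m1[OF x] by (auto simp: slit_def complex_eq_iff)
  qed
  have W': "(W has_vector_derivative f x * W x) (at x)" if x: "x \<in> A" for x
  proof -
    have "((\<lambda>y. ellP (p y) (m y)) has_vector_derivative
        (ellQ (p x) (m x) * p' x + ellR (p x) (m x) * (2 * q x * q' x))) (at x)"
      using x p_slit m1 q_sq_neq_p[OF x] low
      by (intro ellP_path_derivative p m) (auto simp: m_def)
    \<comment> \<open>For \<open>K\<close> the first argument is constantly 0, so the required
      distinctness of the two arguments amounts to \<open>q x \<noteq> 0\<close>.\<close>
    moreover have "((\<lambda>y. ellP 0 (m y)) has_vector_derivative
        (ellQ 0 (m x) * 0 + ellR 0 (m x) * (2 * q x * q' x))) (at x)"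
      using x m1 q_nonzero[OF x] low zero_in_slit
      by (intro ellP_path_derivative m has_vector_derivative_const) (auto simp: m_def)
    ultimately have "((\<lambda>y. ellP (p y) (m y) + r y * ellP 0 (m y)) has_vector_derivative
        ((ellQ (p x) (m x) * p' x + ellR (p x) (m x) * (2 * q x * q' x)) +
         (r x * (ellQ 0 (m x) * 0 + ellR 0 (m x) * (2 * q x * q' x)) + r' x * ellP 0 (m x)))) (at x)"
      by (intro has_vector_derivative_add has_vector_derivative_mult r_deriv x)
    moreover have "(ellQ (p x) (m x) * p' x + ellR (p x) (m x) * (2 * q x * q' x)) +
         (r x * (ellQ 0 (m x) * 0 + ellR 0 (m x) * (2 * q x * q' x)) + r' x * ellP 0 (m x)) =
         f x * (ellP (p x) (m x) + r x * ellP 0 (m x))"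
    proof -
      have "2 * p x * (p x - 1) * (p x - m x) * ellQ (p x) (m x) + p x * ellE (m x)
          + (m x - p x) * ellP 0 (m x) + ((p x)\<^sup>2 - m x) * ellP (p x) (m x) = 0"
      proof (cases "m x \<in> slit")
        case True
        then show ?thesis by (intro ellQ_relation p_slit x)
      next
        case False
        then show ?thesis
          using m1[OF x] by (intro ellQ_relation_lower p_slit x) (auto simp: slit_def complex_eq_iff)
      qed
      note * = elliptic_combination_derivative[OF p_nonzero[OF x] p_neq_1[OF x] q_nonzero[OF x] q'_nonzero[OF x]
          q_sq_neq_p[OF x] m1[OF x, unfolded m_def] r[OF x] f[OF x] ode[OF x] this[unfolded m_def]]
      from * show ?thesis by (simp add: ellR_def m_def algebra_simps)
    qed
    ultimately have "((\<lambda>y. ellP (p y) (m y) + r y * ellP 0 (m y)) has_vector_derivative f x * W x) (at x)"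
      using x by (simp add: W_def Pi_eq K_eq)
    then show ?thesis
      by (rule has_vector_derivative_transform_within_open[OF _ A x]) (simp add: W_def Pi_eq K_eq)
  qed
  define C where "C = (\<lambda>x. W x * exp (- F x))"
  have C': "(C has_derivative (\<lambda>h. 0)) (at x)" if x: "x \<in> A" for x
  proof -
    have "((\<lambda>x. - F x) has_vector_derivative - f x) (at x)"
      using F[OF x] by (rule has_vector_derivative_minus)
    from field_vector_diff_chain_at[OF this DERIV_exp]
    have "((\<lambda>x. exp (- F x)) has_vector_derivative - f x * exp (- F x)) (at x)"
      by (simp add: o_def)
    from has_vector_derivative_mult[OF W'[OF x] this]
    have "(C has_vector_derivative 0) (at x)"
      by (simp add: C_def algebra_simps)
    then show ?thesis by (simp add: has_vector_derivative_def)
  qed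
  show ?thesis
  proof (intro exI[of _ C] conjI ballI)
    fix S assume S: "S \<in> components A"
    have sub: "S \<subseteq> A" using S by (rule in_components_subset)
    have "open S" using A S by (rule open_components)
    moreover have "connected S" using S by (rule in_components_connected)
    ultimately have "C x = C y" if "x \<in> S" "y \<in> S" for x y
      using that sub C' by (intro has_derivative_zero_unique_connected[of S C]) auto
    then show "C constant_on S" unfolding constant_on_def by blast
  next
    fix x assume "x \<in> A"
    show "ellPi (p x) (q x) + r x * ellK (q x) = C x * exp (F x)"
      by (simp add: C_def W_def exp_minus)
  qed
qed

end
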